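(* Let $p\in\{a,e\}^*$ and $\otimes\in\{\mathrm{del},\mathrm{add},\mathrm{edit}\}$. Then: (1) if $p\preceq e^*$, then $\textsc{RM}^{\otimes}_{\mathrm{mon}}(p)\subseteq\mathrm{AC}^0$; (2) if $a\preceq p$, then $\textsc{RM}^{\otimes}_{\mathrm{mon}}(p)\not\subseteq\mathrm{AC}^0$ but $\textsc{RM}^{\otimes}_{\mathrm{mon}}(p)\subseteq\mathrm{TC}^0$.
   Context: A monadic vocabulary $\tau=\{R_1,\dots,R_r\}$ has only unary relation symbols; a finite $\tau$-structure is $\mathcal A=(A,R_1^{\mathcal A},\dots,R_r^{\mathcal A})$ with $R_i^{\mathcal A}\subseteq A$ (ordered). A modulator is $S=(S_1,\dots,S_r)$ with $S_i\subseteq A$; deletion modulator if $S_i\subseteq R_i^{\mathcal A}$, addition modulator if $S_i\cap R_i^{\mathcal A}=\emptyset$; $\mathcal A\triangleright S=(A,R_1^{\mathcal A}\triangle S_1,\dots,R_r^{\mathcal A}\triangle S_r)$, $\|S\|=\sum_i|S_i|$. For a prenex first-order $\tau$-sentence $\phi$, $\textsc{RM}^{\mathrm{edit}}_{\mathrm{mon}}(\phi)$: given $\mathcal A$ and $k\in\mathbb N$, is there a modulator $S$ with $\|S\|\le k$ and $\mathcal A\triangleright S\models\phi$; del/add versions require a deletion/addition modulator. The pattern of $\phi$ is the word over $\{a,e\}$ recording its quantifier prefix ($a$ for $\forall$, $e$ for $\exists$); $\textsc{RM}^{\otimes}_{\mathrm{mon}}(p)$ is the class of all such problems (over any monadic vocabulary)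 for sentences with pattern $p$. $p\preceq q$: $p$ is a subsequence of $q$; $e^*$ denotes the words consisting only of $e$'s. $\mathrm{AC}^0$, $\mathrm{TC}^0$: constant-depth polynomial-size circuit classes without/with threshold gates. *)

theory Defs
  imports Main "HOL-Library.Sublist"
begin

text \<open>A monadic vocabulary with r unary symbols R_0..R_(r-1). A finite structure has
universe {0..<n}; the interpretation is R :: nat => nat set (R i = interpretation of R_i).\<close>

datatype qf =
    Rel nat nat
  | Eq nat nat
  | Neg qf
  | Conj qf qf
  | Disj qf qf

datatype quant = QA | QE

primrec qf_eval :: "(nat \<Rightarrow> nat set) \<Rightarrow> (nat \<Rightarrow> nat) \<Rightarrow> qf \<Rightarrow> bool" where
  "qf_eval R \<sigma> (Rel i v) = (\<sigma> v \<in> R i)"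
| "qf_eval R \<sigma> (Eq v w) = (\<sigma> v = \<sigma> w)"
| "qf_eval R \<sigma> (Neg f) = (\<not> qf_eval R \<sigma> f)"
| "qf_eval R \<sigma> (Conj f g) = (qf_eval R \<sigma> f \<and> qf_eval R \<sigma> g)"
| "qf_eval R \<sigma> (Disj f g) = (qf_eval R \<sigma> f \<or> qf_eval R \<sigma> g)"

primrec qf_vars :: "qf \<Rightarrow> nat set" where
  "qf_vars (Rel i v) = {v}"
| "qf_vars (Eq v w) = {v, w}"
| "qf_vars (Neg f) = qf_vars f"
| "qf_vars (Conj f g) = qf_vars f \<union> qf_vars g"
| "qf_vars (Disj f g) = qf_vars f \<union> qf_vars g"

primrec qf_rels :: "qf \<Rightarrow> nat set" where
  "qf_rels (Rel i v) = {i}"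
| "qf_rels (Eq v w) = {}"
| "qf_rels (Neg f) = qf_rels f"
| "qf_rels (Conj f g) = qf_rels f \<union> qf_rels g"
| "qf_rels (Disj f g) = qf_rels f \<union> qf_rels g"

fun prenex_holds :: "nat \<Rightarrow> (nat \<Rightarrow> nat set) \<Rightarrow> (quant \<times> nat) list \<Rightarrow> qf \<Rightarrow> (nat \<Rightarrow> nat) \<Rightarrow> bool" where
  "prenex_holds n R [] \<psi> \<sigma> = qf_eval R \<sigma> \<psi>"
| "prenex_holds n R ((QA, v) # qs) \<psi> \<sigma> = (\<forall>a<n. prenex_holds n R qs \<psi> (\<sigma>(v := a)))"
| "prenex_holds n R ((QE, v) # qs) \<psi> \<sigma> = (\<exists>a<n. prenex_holds n R qs \<psi> (\<sigma>(v := a)))"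

definition is_sentence :: "nat \<Rightarrow> (quant \<times> nat) list \<Rightarrow> qf \<Rightarrow> bool" where
  "is_sentence r qs \<psi> \<longleftrightarrow> qf_vars \<psi> \<subseteq> set (map snd qs) \<and> qf_rels \<psi> \<subseteq> {..<r}"

text \<open>Satisfaction of a sentence (the assignment is irrelevant for sentences).\<close>
definition models :: "nat \<Rightarrow> (nat \<Rightarrow> nat set) \<Rightarrow> (quant \<times> nat) list \<Rightarrow> qf \<Rightarrow> bool" where
  "models n R qs \<psi> \<longleftrightarrow> prenex_holds n R qs \<psi> (\<lambda>_. 0)"

definition pattern :: "(quant \<times> nat) list \<Rightarrow> quant list" where
  "pattern qs = map fst qs"

datatype modmode = Del | Add | Edit

definition is_struct :: "nat \<Rightarrow> nat \<Rightarrow> (nat \<Rightarrow> nat set) \<Rightarrow> bool" where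
  "is_struct r n R \<longleftrightarrow> (\<forall>i<r. R i \<subseteq> {..<n}) \<and> (\<forall>i\<ge>r. R i = {})"

definition mod_ok :: "modmode \<Rightarrow> nat \<Rightarrow> nat \<Rightarrow> (nat \<Rightarrow> nat set) \<Rightarrow> (nat \<Rightarrow> nat set) \<Rightarrow> bool" where
  "mod_ok m r n R S \<longleftrightarrow> is_struct r n S \<and>
     (case m of Del \<Rightarrow> (\<forall>i<r. S i \<subseteq> R i)
              | Add \<Rightarrow> (\<forall>i<r. S i \<inter> R i = {})
              | Edit \<Rightarrow> True)"

definition mod_norm :: "nat \<Rightarrow> (nat \<Rightarrow> nat set) \<Rightarrow> nat" where
  "mod_norm r S = (\<Sum>i<r. card (S i))"

definition apply_mod :: "(nat \<Rightarrow> nat set) \<Rightarrow> (nat \<Rightarrow> nat set) \<Rightarrow> (nat \<Rightarrow> nat set)" where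
  "apply_mod R S = (\<lambda>i. (R i - S i) \<union> (S i - R i))"

definition RM :: "modmode \<Rightarrow> nat \<Rightarrow> (quant \<times> nat) list \<Rightarrow> qf \<Rightarrow> nat \<Rightarrow> (nat \<Rightarrow> nat set) \<Rightarrow> nat \<Rightarrow> bool" where
  "RM m r qs \<psi> n R k \<longleftrightarrow>
     (\<exists>S. mod_ok m r n R S \<and> mod_norm r S \<le> k \<and> models n (apply_mod R S) qs \<psi>)"

section \<open>Constant-depth circuits (as formulas = unfolded circuits)\<close>

datatype circ =
    Inp nat
  | Cst bool
  | NotG circ
  | AndG "circ list"
  | OrG "circ list"
  | ThrG nat "circ list"

primrec ceval :: "(nat \<Rightarrow> bool) \<Rightarrow> circ \<Rightarrow> bool" where
  "ceval x (Inp j) = x j"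
| "ceval x (Cst b) = b"
| "ceval x (NotG c) = (\<not> ceval x c)"
| "ceval x (AndG cs) = list_all id (map (ceval x) cs)"
| "ceval x (OrG cs) = list_ex id (map (ceval x) cs)"
| "ceval x (ThrG t cs) = (t \<le> length (filter id (map (ceval x) cs)))"

primrec cdepth :: "circ \<Rightarrow> nat" where
  "cdepth (Inp j) = 0"
| "cdepth (Cst b) = 0"
| "cdepth (NotG c) = Suc (cdepth c)"
| "cdepth (AndG cs) = Suc (foldr max (map cdepth cs) 0)"
| "cdepth (OrG cs) = Suc (foldr max (map cdepth cs) 0)"
| "cdepth (ThrG t cs) = Suc (foldr max (map cdepth cs) 0)"

primrec csize :: "circ \<Rightarrow> nat" where
  "csize (Inp j) = 1"
| "csize (Cst b) = 1"
| "csize (NotG c) = Suc (csize c)"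
| "csize (AndG cs) = Suc (sum_list (map csize cs))"
| "csize (OrG cs) = Suc (sum_list (map csize cs))"
| "csize (ThrG t cs) = Suc (sum_list (map csize cs))"

primrec no_thr :: "circ \<Rightarrow> bool" where
  "no_thr (Inp j) = True"
| "no_thr (Cst b) = True"
| "no_thr (NotG c) = no_thr c"
| "no_thr (AndG cs) = list_all no_thr cs"
| "no_thr (OrG cs) = list_all no_thr cs"
| "no_thr (ThrG t cs) = False"

text \<open>Standard encoding of an instance (n, R, k) over r unary symbols as a bit string of
length 2rn: bit i*n+j (i<r, j<n) says j \<in> R_i; bit rn+j (j<rn) says j < k (k in unary,
capped at rn, which is the maximal possible modulator size). Positions beyond are False.\<close>
definition enc :: "nat \<Rightarrow> nat \<Rightarrow> (nat \<Rightarrow> nat set) \<Rightarrow> nat \<Rightarrow> nat \<Rightarrow> bool" where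
  "enc r n R k j =
     (if j < r * n then (j mod n) \<in> R (j div n)
      else if j < 2 * r * n then j - r * n < k
      else False)"

definition decided_by_cd_circuits :: "bool \<Rightarrow> nat \<Rightarrow> (nat \<Rightarrow> (nat \<Rightarrow> nat set) \<Rightarrow> nat \<Rightarrow> bool) \<Rightarrow> bool" where
  "decided_by_cd_circuits thr r P \<longleftrightarrow>
     (\<exists>d c. \<forall>n. \<exists>C. cdepth C \<le> d \<and> csize C \<le> (n + 2) ^ c \<and> (thr \<or> no_thr C) \<and>
        (\<forall>R k. is_struct r n R \<longrightarrow> ceval (enc r n R k) C = P n R k))"

definition in_AC0 :: "nat \<Rightarrow> (nat \<Rightarrow> (nat \<Rightarrow> nat set) \<Rightarrow> nat \<Rightarrow> bool) \<Rightarrow> bool" where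
  "in_AC0 r P \<longleftrightarrow> decided_by_cd_circuits False r P"

definition in_TC0 :: "nat \<Rightarrow> (nat \<Rightarrow> (nat \<Rightarrow> nat set) \<Rightarrow> nat \<Rightarrow> bool) \<Rightarrow> bool" where
  "in_TC0 r P \<longleftrightarrow> decided_by_cd_circuits True r P"

end

theory Submission
  imports
    Defs
    "HOL-Library.Numeral_Type"
    "HOL-Combinatorics.Permutations"
    "HOL-Real_Asymp.Real_Asymp"
begin

text \<open>
  For an existential sentence only the chosen witnesses need to be modified, so the problem is a
  disjunction, over the polynomially many tuples of witnesses, of conditions on boundedly many
  input bits. For an arbitrary sentence the answer depends only on the isomorphism type of the
  structure and on the budget, hence only on how many elements realise each of the boundedly many
  types; threshold gates determine these numbers.

  For the lower bound, let the sentence say that all elements lie outside (or, for additions,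
  inside) a single relation. The problem then asks whether the relation (or its complement) has at
  most \<open>k\<close> elements, and an alternating sum over \<open>k\<close> turns circuits for this into an approximation
  of parity. By the Razborov--Smolensky method over the field with three elements, small circuits of
  constant depth agree on most inputs with a polynomial of polylogarithmic degree, while a polynomial
  of degree well below \<open>sqrt n\<close> cannot agree with parity on nearly all inputs.
\<close>

section \<open>Circuit families of polynomial size\<close>

text \<open>The base \<open>n + 2\<close> is the one in \<open>decided_by_cd_circuits\<close>. It is
  at least 2 even for \<open>n = 0\<close>, so a power of it absorbs any constant.\<close>

definition poly_bounded :: "(nat \<Rightarrow> nat) \<Rightarrow> bool" where
  "poly_bounded f \<longleftrightarrow> (\<exists>c. \<forall>n. f n \<le> (n + 2) ^ c)"

lemma poly_bounded_const: "poly_bounded (\<lambda>_. K)"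
  unfolding poly_bounded_def
proof (intro exI allI)
  fix n :: nat
  have "K \<le> 2 ^ K"
    by (simp add: less_imp_le)
  also have "\<dots> \<le> (n + 2) ^ K"
    by (rule power_mono) auto
  finally show "K \<le> (n + 2) ^ K" .
qed

lemma poly_bounded_id: "poly_bounded (\<lambda>n. n)"
  unfolding poly_bounded_def by (rule exI[of _ 1]) simp

lemma poly_bounded_mult:
  assumes "poly_bounded f" "poly_bounded g"
  shows "poly_bounded (\<lambda>n. f n * g n)"
proof -
  obtain c c' where "\<And>n. f n \<le> (n + 2) ^ c" "\<And>n. g n \<le> (n + 2) ^ c'"
    using assms unfolding poly_bounded_def by auto
  then have "f n * g n \<le> (n + 2) ^ (c + c')" for n
    by (simp add: power_add mult_le_mono)
  then show ?thesis unfolding poly_bounded_def by blast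
qed

lemma poly_bounded_add:
  assumes "poly_bounded f" "poly_bounded g"
  shows "poly_bounded (\<lambda>n. f n + g n)"
proof -
  obtain c c' where f: "\<And>n. f n \<le> (n + 2) ^ c" and g: "\<And>n. g n \<le> (n + 2) ^ c'"
    using assms unfolding poly_bounded_def by auto
  have "f n + g n \<le> (n + 2) ^ (c + c' + 1)" for n
  proof -
    have "f n \<le> (n + 2) ^ (c + c')"
      using f[of n] power_increasing[of c "c + c'" "n + 2"] by linarith
    moreover have "g n \<le> (n + 2) ^ (c + c')"
      using g[of n] power_increasing[of c' "c + c'" "n + 2"] by linarith
    ultimately have "f n + g n \<le> 2 * (n + 2) ^ (c + c')" by linarith
    also have "\<dots> \<le> (n + 2) * (n + 2) ^ (c + c')" by (rule mult_le_mono) auto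
    finally show ?thesis by simp
  qed
  then show ?thesis unfolding poly_bounded_def by blast
qed

lemma poly_bounded_power:
  assumes "poly_bounded f"
  shows "poly_bounded (\<lambda>n. f n ^ k)"
proof (induction k)
  case 0
  show ?case using poly_bounded_const[of 1] by simp
next
  case (Suc k)
  then show ?case using poly_bounded_mult[OF assms] by simp
qed

lemmas poly_bounded_intros =
  poly_bounded_const poly_bounded_id poly_bounded_add poly_bounded_mult poly_bounded_power

text \<open>Lets the size bound be any expression \<open>s\<close> that
  \<open>poly_bounded_intros\<close> can handle, instead of an explicit power of
  \<open>n + 2\<close>.\<close>

lemma decided_by_cd_circuitsI:
  assumes "poly_bounded s"
    and "\<And>n. cdepth (C n) \<le> d" "\<And>n. csize (C n) \<le> s n" "\<And>n. thr \<or> no_thr (C n)"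
    and "\<And>n R k. is_struct r n R \<Longrightarrow> ceval (enc r n R k) (C n) = P n R k"
  shows "decided_by_cd_circuits thr r P"
proof -
  obtain c where "\<And>n. s n \<le> (n + 2) ^ c"
    using assms(1) unfolding poly_bounded_def by auto
  then have "csize (C n) \<le> (n + 2) ^ c" for n
    using assms(3) le_trans by blast
  then show ?thesis
    unfolding decided_by_cd_circuits_def using assms(2,4,5) by blast
qed

lemma foldr_max_le_iff: "foldr max xs 0 \<le> d \<longleftrightarrow> (\<forall>x\<in>set xs. x \<le> d)" for d :: nat
  by (induction xs) auto

lemma sum_list_map_le:
  fixes f :: "'a \<Rightarrow> nat"
  assumes "\<And>x. x \<in> set xs \<Longrightarrow> f x \<le> s"
  shows "sum_list (map f xs) \<le> length xs * s"
  using assms by (induction xs) (auto intro: add_mono)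

section \<open>Existential sentences\<close>

definition minterm :: "nat list \<Rightarrow> nat list \<Rightarrow> circ" where
  "minterm js T = AndG (map (\<lambda>j. if j \<in> set T then Inp j else NotG (Inp j)) js)"

text \<open>The disjunctive normal form of an arbitrary \<open>g\<close> on the positions
  \<open>js\<close>. Its size is exponential in \<open>length js\<close> only, hence constant when
  the number of positions is bounded.\<close>

definition junta :: "nat list \<Rightarrow> (nat set \<Rightarrow> bool) \<Rightarrow> circ" where
  "junta js g = OrG (map (minterm js) (filter (\<lambda>T. g (set T)) (subseqs js)))"

lemma ceval_minterm: "ceval x (minterm js T) \<longleftrightarrow> (\<forall>j\<in>set js. x j \<longleftrightarrow> j \<in> set T)"
  by (auto simp: minterm_def list_all_iff)

lemma ceval_junta: "ceval x (junta js g) \<longleftrightarrow> g {j \<in> set js. x j}"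
proof -
  have "ceval x (junta js g) \<longleftrightarrow>
      (\<exists>T\<in>set (subseqs js). g (set T) \<and> (\<forall>j\<in>set js. x j \<longleftrightarrow> j \<in> set T))"
    by (auto simp: junta_def list_ex_iff ceval_minterm)
  also have "\<dots> \<longleftrightarrow> (\<exists>T\<in>set ` set (subseqs js). g T \<and> (\<forall>j\<in>set js. x j \<longleftrightarrow> j \<in> T))"
    by blast
  also have "\<dots> \<longleftrightarrow> (\<exists>T\<in>Pow (set js). g T \<and> T = {j \<in> set js. x j})"
    unfolding subseqs_powset by (intro bex_cong refl) auto
  also have "\<dots> \<longleftrightarrow> g {j \<in> set js. x j}" by auto
  finally show ?thesis .
qed

lemma csize_minterm: "csize (minterm js T) \<le> Suc (length js * 2)"
  unfolding minterm_def csize.simps map_map comp_def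
  by (intro Suc_le_mono[THEN iffD2] sum_list_map_le) auto

lemma csize_junta: "csize (junta js g) \<le> Suc (2 ^ length js * Suc (length js * 2))"
proof -
  have "csize (junta js g) \<le>
      Suc (length (filter (\<lambda>T. g (set T)) (subseqs js)) * Suc (length js * 2))"
    unfolding junta_def csize.simps map_map comp_def
    by (intro Suc_le_mono[THEN iffD2] sum_list_map_le csize_minterm)
  also have "\<dots> \<le> Suc (2 ^ length js * Suc (length js * 2))"
    using length_filter_le[of _ "subseqs js"] by (simp only: length_subseqs Suc_le_mono mult_le_mono1)
  finally show ?thesis .
qed

lemma cdepth_minterm: "cdepth (minterm js T) \<le> 2"
  by (auto simp: minterm_def foldr_max_le_iff numeral_2_eq_2)

lemma cdepth_junta: "cdepth (junta js g) \<le> 3"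
  using cdepth_minterm by (auto simp: junta_def foldr_max_le_iff numeral_3_eq_3 numeral_2_eq_2)

lemma no_thr_junta: "no_thr (junta js g)"
  by (auto simp: junta_def minterm_def list_all_iff)

section \<open>Bits of the encoding and values of assigned variables\<close>

lemma enc_rel: "i < r \<Longrightarrow> a < n \<Longrightarrow> enc r n R k (i * n + a) \<longleftrightarrow> a \<in> R i"
proof -
  assume "i < r" "a < n"
  then have "i * n + a < Suc i * n" "Suc i * n \<le> r * n"
    by (simp, intro mult_le_mono1) auto
  then have "i * n + a < r * n" by linarith
  then show ?thesis using \<open>a < n\<close> by (simp add: enc_def)
qed

lemma enc_budget: "enc r n R k (r * n + j) \<longleftrightarrow> j < r * n \<and> j < k"
proof -
  have "r * n + j < 2 * r * n \<longleftrightarrow> j < r * n" by linarith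
  then show ?thesis unfolding enc_def by (simp only: not_add_less1 diff_add_inverse simp_thms if_bool_eq_conj) blast
qed

text \<open>Updates are performed from left to right, so a later binding of the same variable wins,
  just as an inner quantifier shadows an outer one.\<close>

definition assign :: "(nat \<Rightarrow> nat) \<Rightarrow> nat list \<Rightarrow> nat list \<Rightarrow> nat \<Rightarrow> nat" where
  "assign \<sigma> vs as = fold (\<lambda>(v, a) \<tau>. \<tau>(v := a)) (zip vs as) \<sigma>"

lemma assign_Cons: "assign \<sigma> (v # vs) (a # as) = assign (\<sigma>(v := a)) vs as"
  by (simp add: assign_def)

lemma assign_notin: "v \<notin> set vs \<Longrightarrow> assign \<sigma> vs as v = \<sigma> v"
proof (induction vs arbitrary: \<sigma> as)
  case (Cons w vs)
  then show ?case by (cases as) (auto simp: assign_Cons, auto simp: assign_def)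
qed (simp add: assign_def)

lemma assign_in:
  "length as = length vs \<Longrightarrow> v \<in> set vs \<Longrightarrow> assign \<sigma> vs as v \<in> set as"
proof (induction vs arbitrary: \<sigma> as)
  case (Cons w vs)
  then obtain a as' where as: "as = a # as'" by (cases as) auto
  show ?case
  proof (cases "v \<in> set vs")
    case True
    then show ?thesis using Cons as by (simp add: assign_Cons)
  next
    case False
    then have "v = w" using Cons.prems by simp
    then show ?thesis using False as by (simp add: assign_Cons assign_notin)
  qed
qed simp

section \<open>Reduction of existential sentences to tuples of witnesses\<close>

lemma prenex_holds_QE:
  assumes "set (map fst qs) \<subseteq> {QE}"
  shows "prenex_holds n R qs \<psi> \<sigma> \<longleftrightarrow>
    (\<exists>as. length as = length qs \<and> set as \<subseteq> {..<n} \<and> qf_eval R (assign \<sigma> (map snd qs) as) \<psi>)"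
  using assms
proof (induction qs arbitrary: \<sigma>)
  case (Cons q qs)
  obtain v where q: "q = (QE, v)" using Cons.prems by (cases q) auto
  have "prenex_holds n R (q # qs) \<psi> \<sigma> \<longleftrightarrow> (\<exists>a<n. \<exists>as. length as = length qs \<and> set as \<subseteq> {..<n} \<and>
      qf_eval R (assign \<sigma> (map snd (q # qs)) (a # as)) \<psi>)"
    using Cons by (simp add: q assign_Cons)
  also have "\<dots> \<longleftrightarrow> (\<exists>as. length as = length (q # qs) \<and> set as \<subseteq> {..<n} \<and>
      qf_eval R (assign \<sigma> (map snd (q # qs)) as) \<psi>)" (is "?l \<longleftrightarrow> ?r")
  proof
    assume ?l
    then obtain a as where "a < n" "length as = length qs" "set as \<subseteq> {..<n}"
      "qf_eval R (assign \<sigma> (map snd (q # qs)) (a # as)) \<psi>" by blast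
    then show ?r by (intro exI[of _ "a # as"]) simp
  next
    assume ?r
    then show ?l by (metis (no_types, lifting) length_Suc_conv list.set_intros(1) list.simps(15)
          insert_subset lessThan_iff length_Cons)
  qed
  finally show ?case .
qed (simp add: assign_def)

lemma qf_eval_cong:
  assumes "\<And>v. v \<in> qf_vars \<psi> \<Longrightarrow> \<sigma> v = \<tau> v"
    and "\<And>i v. i \<in> qf_rels \<psi> \<Longrightarrow> v \<in> qf_vars \<psi> \<Longrightarrow> \<sigma> v \<in> R i \<longleftrightarrow> \<sigma> v \<in> R' i"
  shows "qf_eval R \<sigma> \<psi> = qf_eval R' \<tau> \<psi>"
  using assms by (induction \<psi>) auto

text \<open>Besides fixing the values of the quantified variables, this confines the modulator to
  these values; that is what makes the condition local.\<close>

definition witness :: "modmode \<Rightarrow> nat \<Rightarrow> (quant \<times> nat) list \<Rightarrow> qf \<Rightarrow> nat \<Rightarrow> nat list \<Rightarrow>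
    (nat \<Rightarrow> nat set) \<Rightarrow> nat \<Rightarrow> bool" where
  "witness m r qs \<psi> n as R k \<longleftrightarrow> (\<exists>S. mod_ok m r n R S \<and> mod_norm r S \<le> k \<and>
     (\<forall>i. S i \<subseteq> set as) \<and> qf_eval (apply_mod R S) (assign (\<lambda>_. 0) (map snd qs) as) \<psi>)"

lemma finite_modulator: "is_struct r n S \<Longrightarrow> finite (S i)"
  unfolding is_struct_def by (metis finite.emptyI finite_lessThan finite_subset not_le)

text \<open>The matrix inspects only elements of the tuple. Cutting a modulator down to these
  elements therefore preserves truth, keeps the deletion or addition condition, and cannot increase
  the norm.\<close>

lemma RM_iff_witness:
  assumes "is_sentence r qs \<psi>" "set (map fst qs) \<subseteq> {QE}"
  shows "RM m r qs \<psi> n R k \<longleftrightarrow>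
    (\<exists>as. length as = length qs \<and> set as \<subseteq> {..<n} \<and> witness m r qs \<psi> n as R k)"
proof
  assume "RM m r qs \<psi> n R k"
  then obtain S as where S: "mod_ok m r n R S" "mod_norm r S \<le> k"
    and as: "length as = length qs" "set as \<subseteq> {..<n}"
    and ev: "qf_eval (apply_mod R S) (assign (\<lambda>_. 0) (map snd qs) as) \<psi>"
    unfolding RM_def models_def prenex_holds_QE[OF assms(2)] by blast
  define S' where "S' = (\<lambda>i. S i \<inter> set as)"
  have "mod_ok m r n R S'"
    using S(1) by (auto simp: mod_ok_def is_struct_def S'_def split: modmode.splits)
  moreover have "mod_norm r S' \<le> mod_norm r S"
    unfolding mod_norm_def S'_def using S(1)
    by (intro sum_mono card_mono) (auto simp: mod_ok_def intro: finite_modulator)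
  moreover have "qf_eval (apply_mod R S') (assign (\<lambda>_. 0) (map snd qs) as) \<psi>"
  proof (rule qf_eval_cong[THEN iffD1, OF _ _ ev])
    fix i v assume "v \<in> qf_vars \<psi>"
    then have "assign (\<lambda>_. 0) (map snd qs) as v \<in> set as"
      using assms(1) as(1) by (intro assign_in) (auto simp: is_sentence_def)
    then show "assign (\<lambda>_. 0) (map snd qs) as v \<in> apply_mod R S i \<longleftrightarrow>
        assign (\<lambda>_. 0) (map snd qs) as v \<in> apply_mod R S' i"
      by (auto simp: apply_mod_def S'_def)
  qed simp
  ultimately have "witness m r qs \<psi> n as R k"
    unfolding witness_def using S(2) by (intro exI[of _ S']) (auto simp: S'_def)
  then show "\<exists>as. length as = length qs \<and> set as \<subseteq> {..<n} \<and> witness m r qs \<psi> n as R k"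
    using as by blast
next
  assume "\<exists>as. length as = length qs \<and> set as \<subseteq> {..<n} \<and> witness m r qs \<psi> n as R k"
  then show "RM m r qs \<psi> n R k"
    unfolding RM_def models_def witness_def prenex_holds_QE[OF assms(2)] by blast
qed

lemma mod_norm_le:
  assumes "\<And>i. i < r \<Longrightarrow> S i \<subseteq> A" "finite A"
  shows "mod_norm r S \<le> r * card A"
  unfolding mod_norm_def
  using sum_bounded_above[of "{..<r}" "\<lambda>i. card (S i)" "card A"] assms by (simp add: card_mono)

text \<open>The membership bits of the tuple, and the first \<open>r * length as\<close> budget
  bits: a modulator confined to the tuple never costs more than that.\<close>

definition witness_bits :: "nat \<Rightarrow> nat \<Rightarrow> nat list \<Rightarrow> nat list" where
  "witness_bits r n as =
     concat (map (\<lambda>i. map (\<lambda>a. i * n + a) as) [0..<r]) @ [r * n..<r * n + r * length as]"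

lemma length_witness_bits: "length (witness_bits r n as) = 2 * (r * length as)"
  by (simp add: witness_bits_def length_concat comp_def sum_list_triv)

lemma set_witness_bits:
  "set (witness_bits r n as) =
     {i * n + a |i a. i < r \<and> a \<in> set as} \<union> {r * n + j |j. j < r * length as}"
proof -
  have "{r * n..<r * n + r * length as} = {r * n + j |j. j < r * length as}"
    by (auto simp: le_iff_add)
  then show ?thesis by (auto simp: witness_bits_def)
qed

text \<open>The same modulator serves both instances, since mode condition, budget and matrix can
  all be checked on the listed bits.\<close>

lemma witness_depends_on_bits:
  assumes sent: "is_sentence r qs \<psi>"
    and as: "length as = length qs" "set as \<subseteq> {..<n}"
    and bits: "\<And>j. j \<in> set (witness_bits r n as) \<Longrightarrow> enc r n R k j = enc r n R' k' j"
    and wit: "witness m r qs \<psi> n as R k"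
  shows "witness m r qs \<psi> n as R' k'"
proof -
  obtain S where S: "mod_ok m r n R S" "mod_norm r S \<le> k" "\<And>i. S i \<subseteq> set as"
    and ev: "qf_eval (apply_mod R S) (assign (\<lambda>_. 0) (map snd qs) as) \<psi>"
    using wit unfolding witness_def by blast
  have eq: "a \<in> R i \<longleftrightarrow> a \<in> R' i" if "i < r" "a \<in> set as" for i a
  proof -
    have "i * n + a \<in> set (witness_bits r n as)" using that by (auto simp: set_witness_bits)
    moreover have "a < n" using that as by auto
    ultimately show ?thesis using bits enc_rel that(1) by metis
  qed
  have "mod_ok m r n R' S"
    using S(1,3) eq by (fastforce simp: mod_ok_def split: modmode.splits)
  moreover have "mod_norm r S \<le> k'"
  proof (cases "mod_norm r S")
    \<comment> \<open>A norm of \<open>Suc s\<close> fits the budget iff \<open>s < k\<close>, which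
      is budget bit \<open>s\<close>. This bit must be listed and must also lie below the cap
      \<open>r * n\<close>; the two norm bounds below provide this.\<close>
    case (Suc s)
    have "mod_norm r S \<le> r * card (set as)" using S(3) by (intro mod_norm_le) auto
    also have "\<dots> \<le> r * length as" by (simp add: card_length)
    finally have "r * n + s \<in> set (witness_bits r n as)" using Suc by (auto simp: set_witness_bits)
    moreover have "mod_norm r S \<le> r * card {..<n}"
      using S(3) as(2) by (intro mod_norm_le) auto
    ultimately show ?thesis using bits[of "r * n + s"] S(2) Suc by (simp add: enc_budget)
  qed simp
  moreover have "qf_eval (apply_mod R' S) (assign (\<lambda>_. 0) (map snd qs) as) \<psi>"
  proof (rule qf_eval_cong[THEN iffD1, OF _ _ ev])
    fix i v assume "i \<in> qf_rels \<psi>" "v \<in> qf_vars \<psi>"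
    then have "i < r" "assign (\<lambda>_. 0) (map snd qs) as v \<in> set as"
      using sent as(1) by (auto intro!: assign_in simp: is_sentence_def)
    then show "assign (\<lambda>_. 0) (map snd qs) as v \<in> apply_mod R S i \<longleftrightarrow>
        assign (\<lambda>_. 0) (map snd qs) as v \<in> apply_mod R' S i"
      using eq by (auto simp: apply_mod_def)
  qed simp
  ultimately show ?thesis unfolding witness_def using S(3) by blast
qed

theorem RM_in_AC0_if_existential:
  assumes sent: "is_sentence r qs \<psi>" and ex: "set (map fst qs) \<subseteq> {QE}"
  shows "in_AC0 r (RM m r qs \<psi>)"
proof -
  define l where "l = length qs"
  \<comment> \<open>\<open>J\<close> is accepted if some instance showing exactly these bits has the
    witness property; by \<open>witness_depends_on_bits\<close> all instances showing
    \<open>J\<close> then agree.\<close>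
  define g where "g n as J \<longleftrightarrow> (\<exists>R k. is_struct r n R \<and>
      J = {j \<in> set (witness_bits r n as). enc r n R k j} \<and> witness m r qs \<psi> n as R k)" for n as J
  define C where "C n = OrG (map (\<lambda>as. junta (witness_bits r n as) (g n as))
      (List.n_lists l [0..<n]))" for n
  define K where "K = Suc (2 ^ (2 * (r * l)) * Suc (2 * (r * l) * 2))"
  have g: "g n as {j \<in> set (witness_bits r n as). enc r n R k j} \<longleftrightarrow> witness m r qs \<psi> n as R k"
    if as: "length as = length qs" "set as \<subseteq> {..<n}" and R: "is_struct r n R" for n as R k
  proof
    assume "g n as {j \<in> set (witness_bits r n as). enc r n R k j}"
    then obtain R' k' where
      "{j \<in> set (witness_bits r n as). enc r n R k j} =
        {j \<in> set (witness_bits r n as). enc r n R' k' j}"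
      "witness m r qs \<psi> n as R' k'" unfolding g_def by blast
    then show "witness m r qs \<psi> n as R k"
      using witness_depends_on_bits[OF sent as] by blast
  qed (use R in \<open>unfold g_def, blast\<close>)
  show ?thesis
    unfolding in_AC0_def
  \<comment> \<open>One disjunction over the \<open>n ^ l\<close> tuples sits on top of juntas of
    depth 3 and constant size at most \<open>K\<close>.\<close>
  proof (rule decided_by_cd_circuitsI[where C = C and d = 4 and s = "\<lambda>n. 1 + n ^ l * K"])
    show "poly_bounded (\<lambda>n. 1 + n ^ l * K)" by (intro poly_bounded_intros)
  next
    fix n
    show "cdepth (C n) \<le> 4"
      using cdepth_junta by (fastforce simp: C_def foldr_max_le_iff)
    have "csize (C n) \<le> Suc (length (List.n_lists l [0..<n]) * K)"
      unfolding C_def csize.simps map_map comp_def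
    proof (intro Suc_le_mono[THEN iffD2] sum_list_map_le)
      fix as assume "as \<in> set (List.n_lists l [0..<n])"
      then show "csize (junta (witness_bits r n as) (g n as)) \<le> K"
        using csize_junta[of "witness_bits r n as" "g n as"]
        by (simp only: length_witness_bits length_n_lists_elem K_def)
    qed
    then show "csize (C n) \<le> 1 + n ^ l * K" by (simp add: length_n_lists)
    show "False \<or> no_thr (C n)" by (auto simp: C_def list_all_iff no_thr_junta)
    fix R k assume R: "is_struct r n R"
    have "ceval (enc r n R k) (C n) \<longleftrightarrow> (\<exists>as. length as = length qs \<and> set as \<subseteq> {..<n} \<and>
        g n as {j \<in> set (witness_bits r n as). enc r n R k j})"
      by (auto simp: C_def list_ex_iff ceval_junta set_n_lists l_def atLeast0LessThan)
    also have "\<dots> \<longleftrightarrow> RM m r qs \<psi> n R k"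
      unfolding RM_iff_witness[OF sent ex] using g[OF _ _ R] by blast
    finally show "ceval (enc r n R k) (C n) = RM m r qs \<psi> n R k" .
  qed
qed

section \<open>All sentences: counting types with threshold gates\<close>

definition exactly :: "nat \<Rightarrow> circ list \<Rightarrow> circ" where
  "exactly N cs = AndG [ThrG N cs, NotG (ThrG (Suc N) cs)]"

definition counts :: "(nat \<Rightarrow> bool) \<Rightarrow> circ list list \<Rightarrow> nat list" where
  "counts x Fs = map (\<lambda>cs. length (filter (ceval x) cs)) Fs"

text \<open>Computes an arbitrary \<open>g\<close> of the count vector by guessing the vector. There
  are \<open>Suc M ^ length Fs\<close> candidates, polynomially many when the number of lists is
  fixed.\<close>

definition counting :: "circ list list \<Rightarrow> nat \<Rightarrow> (nat list \<Rightarrow> bool) \<Rightarrow> circ" where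
  "counting Fs M g = OrG (map (\<lambda>v. AndG (map2 exactly v Fs))
     (filter g (List.n_lists (length Fs) [0..<Suc M])))"

lemma ceval_exactly: "ceval x (exactly N cs) \<longleftrightarrow> N = length (filter (ceval x) cs)"
  by (auto simp: exactly_def filter_map comp_def)

lemma ceval_exactly_all:
  "length v = length Fs \<Longrightarrow> ceval x (AndG (map2 exactly v Fs)) \<longleftrightarrow> v = counts x Fs"
  by (induction v Fs rule: list_induct2) (auto simp: ceval_exactly counts_def)

text \<open>The length bound guarantees that the true count vector is among the enumerated
  candidates.\<close>

lemma ceval_counting:
  assumes "\<And>cs. cs \<in> set Fs \<Longrightarrow> length cs \<le> M"
  shows "ceval x (counting Fs M g) \<longleftrightarrow> g (counts x Fs)"
proof -
  have "N < Suc M" if "N \<in> set (counts x Fs)" for N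
    using assms that by (auto simp: counts_def less_Suc_eq_le intro: le_trans[OF length_filter_le])
  then have *: "counts x Fs \<in> set (List.n_lists (length Fs) [0..<Suc M])"
    unfolding set_n_lists by (auto simp: counts_def simp del: upt_Suc)
  have "ceval x (counting Fs M g) \<longleftrightarrow>
      (\<exists>v\<in>set (List.n_lists (length Fs) [0..<Suc M]). g v \<and> ceval x (AndG (map2 exactly v Fs)))"
    by (auto simp: counting_def list_ex_iff simp del: ceval.simps(4) upt_Suc)
  also have "\<dots> \<longleftrightarrow> (\<exists>v\<in>set (List.n_lists (length Fs) [0..<Suc M]). g v \<and> v = counts x Fs)"
    by (intro bex_cong refl conj_cong ceval_exactly_all) (simp add: length_n_lists_elem)
  also have "\<dots> \<longleftrightarrow> g (counts x Fs)" using * by blast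
  finally show ?thesis .
qed

text \<open>The five additional levels are the threshold gate, its negation, the two conjunctions
  and the outer disjunction.\<close>

lemma cdepth_counting:
  assumes "\<And>cs c. cs \<in> set Fs \<Longrightarrow> c \<in> set cs \<Longrightarrow> cdepth c \<le> d"
  shows "cdepth (counting Fs M g) \<le> d + 5"
proof -
  have "cdepth (ThrG N cs) \<le> Suc d" if "cs \<in> set Fs" for N cs
    using assms that by (auto simp: foldr_max_le_iff)
  then have "cdepth (exactly N cs) \<le> d + 3" if "cs \<in> set Fs" for N cs
    using that by (fastforce simp: exactly_def)
  then have "cdepth (AndG (map2 exactly v Fs)) \<le> d + 4" for v
    by (auto simp: foldr_max_le_iff add.commute dest: set_zip_rightD)
  then show ?thesis
    by (auto simp: counting_def foldr_max_le_iff add.commute simp del: cdepth.simps(4) upt_Suc)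
qed

lemma csize_counting:
  assumes "\<And>cs. cs \<in> set Fs \<Longrightarrow> length cs \<le> M"
    and "\<And>cs c. cs \<in> set Fs \<Longrightarrow> c \<in> set cs \<Longrightarrow> csize c \<le> s"
  shows "csize (counting Fs M g) \<le> 1 + Suc M ^ length Fs * (1 + length Fs * (4 + 2 * (M * s)))"
proof -
  have thr: "csize (ThrG N cs) \<le> Suc (M * s)" if "cs \<in> set Fs" for N cs
  proof -
    have "csize (ThrG N cs) \<le> Suc (length cs * s)"
      using assms(2)[OF that] by (simp add: sum_list_map_le)
    also have "\<dots> \<le> Suc (M * s)" using assms(1)[OF that] by simp
    finally show ?thesis .
  qed
  have exactly: "csize (exactly N cs) \<le> 4 + 2 * (M * s)" if "cs \<in> set Fs" for N cs
    using thr[OF that, of N] thr[OF that, of "Suc N"] by (simp add: exactly_def)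
  have conj: "csize (AndG (map2 exactly v Fs)) \<le> 1 + length Fs * (4 + 2 * (M * s))"
    if "length v = length Fs" for v
  proof -
    have "sum_list (map (\<lambda>p. csize (case p of (N, cs) \<Rightarrow> exactly N cs)) (zip v Fs)) \<le>
        length (zip v Fs) * (4 + 2 * (M * s))"
      by (intro sum_list_map_le) (auto dest!: set_zip_rightD intro!: exactly)
    then show ?thesis using that by (simp add: comp_def)
  qed
  define vs where "vs = filter g (List.n_lists (length Fs) [0..<Suc M])"
  have "csize (counting Fs M g) \<le> 1 + length vs * (1 + length Fs * (4 + 2 * (M * s)))"
  proof -
    have "sum_list (map (\<lambda>v. csize (AndG (map2 exactly v Fs))) vs) \<le>
        length vs * (1 + length Fs * (4 + 2 * (M * s)))"
      by (intro sum_list_map_le conj) (auto simp: vs_def length_n_lists_elem)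
    then show ?thesis
      unfolding counting_def vs_def[symmetric] csize.simps(5) map_map comp_def by linarith
  qed
  also have "\<dots> \<le> 1 + Suc M ^ length Fs * (1 + length Fs * (4 + 2 * (M * s)))"
  proof -
    have "length vs \<le> Suc M ^ length Fs"
      using length_filter_le[of g "List.n_lists (length Fs) [0..<Suc M]"]
      by (simp only: vs_def length_n_lists length_upt diff_zero)
    then show ?thesis by (intro add_mono order_refl mult_le_mono1)
  qed
  finally show ?thesis .
qed

section \<open>Invariance under isomorphism\<close>

lemma prenex_holds_permutes:
  assumes "\<pi> permutes {..<n}"
  shows "prenex_holds n (\<lambda>i. \<pi> ` R i) qs \<psi> (\<pi> \<circ> \<sigma>) \<longleftrightarrow> prenex_holds n R qs \<psi> \<sigma>"
proof (induction qs arbitrary: \<sigma>)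
  case Nil
  have inj: "inj \<pi>" using assms by (rule permutes_inj)
  have "qf_eval (\<lambda>i. \<pi> ` R i) (\<pi> \<circ> \<sigma>) \<psi> \<longleftrightarrow> qf_eval R \<sigma> \<psi>"
    by (induction \<psi>) (simp_all add: inj_image_mem_iff[OF inj] inj_eq[OF inj])
  then show ?case by (simp only: prenex_holds.simps)
next
  case (Cons q qs)
  obtain Q v where q: "q = (Q, v)" by (cases q)
  have upd: "(\<pi> \<circ> \<sigma>)(v := \<pi> a) = \<pi> \<circ> \<sigma>(v := a)" for a by auto
  have img: "{..<n} = \<pi> ` {..<n}" using assms by (simp add: permutes_image)
  have all: "(\<forall>a<n. T a) \<longleftrightarrow> (\<forall>a<n. T (\<pi> a))" and ex: "(\<exists>a<n. T a) \<longleftrightarrow> (\<exists>a<n. T (\<pi> a))" for T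
    using img by (metis imageE imageI lessThan_iff)+
  let ?T = "\<lambda>a. prenex_holds n (\<lambda>i. \<pi> ` R i) qs \<psi> ((\<pi> \<circ> \<sigma>)(v := a))"
  have "?T (\<pi> a) \<longleftrightarrow> prenex_holds n R qs \<psi> (\<sigma>(v := a))" for a
    by (simp only: upd Cons.IH)
  then show ?case
    using all[of ?T] ex[of ?T] by (cases Q) (simp_all only: q prenex_holds.simps)
qed

lemma prenex_holds_cong:
  assumes "\<And>v. v \<in> qf_vars \<psi> - set (map snd qs) \<Longrightarrow> \<sigma> v = \<tau> v"
  shows "prenex_holds n R qs \<psi> \<sigma> \<longleftrightarrow> prenex_holds n R qs \<psi> \<tau>"
  using assms
proof (induction qs arbitrary: \<sigma> \<tau>)
  case Nil
  then show ?case by (auto intro!: qf_eval_cong)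
next
  case (Cons q qs)
  obtain Q v where q: "q = (Q, v)" by (cases q)
  have "prenex_holds n R qs \<psi> (\<sigma>(v := a)) \<longleftrightarrow> prenex_holds n R qs \<psi> (\<tau>(v := a))" for a
    using Cons.prems by (intro Cons.IH) (auto simp: q)
  then show ?case by (cases Q) (simp_all add: q)
qed

lemma models_permutes:
  assumes "is_sentence r qs \<psi>" "\<pi> permutes {..<n}"
  shows "models n (\<lambda>i. \<pi> ` R i) qs \<psi> \<longleftrightarrow> models n R qs \<psi>"
proof -
  \<comment> \<open>\<open>models\<close> starts from the constant assignment 0, but transport along
    \<open>\<pi>\<close> yields the constant \<open>\<pi> 0\<close>; for a sentence the two are
    interchangeable.\<close>
  have "models n (\<lambda>i. \<pi> ` R i) qs \<psi> \<longleftrightarrow> prenex_holds n (\<lambda>i. \<pi> ` R i) qs \<psi> (\<pi> \<circ> (\<lambda>_. 0))"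
    unfolding models_def using assms(1) by (intro prenex_holds_cong) (auto simp: is_sentence_def)
  then show ?thesis using prenex_holds_permutes[OF assms(2)] by (simp add: models_def)
qed

lemma RM_permutes:
  assumes "is_sentence r qs \<psi>" "\<pi> permutes {..<n}" "RM m r qs \<psi> n R k"
  shows "RM m r qs \<psi> n (\<lambda>i. \<pi> ` R i) k"
proof -
  obtain S where S: "mod_ok m r n R S" "mod_norm r S \<le> k" "models n (apply_mod R S) qs \<psi>"
    using assms(3) unfolding RM_def by blast
  have inj: "inj \<pi>" using assms(2) by (rule permutes_inj)
  have "\<pi> ` S i \<subseteq> {..<n}" if "S i \<subseteq> {..<n}" for i
    using image_mono[OF that, of \<pi>] by (simp only: permutes_image[OF assms(2)])
  then have "is_struct r n (\<lambda>i. \<pi> ` S i)"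
    using S(1) by (simp add: mod_ok_def is_struct_def)
  then have "mod_ok m r n (\<lambda>i. \<pi> ` R i) (\<lambda>i. \<pi> ` S i)"
    using S(1) image_mono[of _ _ \<pi>]
    by (cases m) (simp_all add: mod_ok_def image_Int[OF inj, symmetric])
  moreover have "mod_norm r (\<lambda>i. \<pi> ` S i) = mod_norm r S"
    unfolding mod_norm_def by (simp add: card_image inj_on_subset[OF inj])
  moreover have "apply_mod (\<lambda>i. \<pi> ` R i) (\<lambda>i. \<pi> ` S i) = (\<lambda>i. \<pi> ` apply_mod R S i)"
    by (simp add: apply_mod_def image_Un image_set_diff[OF inj])
  ultimately show ?thesis
    unfolding RM_def using S(2,3) models_permutes[OF assms(1,2)] by metis
qed

text \<open>No modulator has norm above \<open>r * n\<close>, so capping the budget there, as the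
  encoding does, loses nothing.\<close>

lemma RM_min:
  "RM m r qs \<psi> n R (min k (r * n)) \<longleftrightarrow> RM m r qs \<psi> n R k"
proof -
  have "mod_norm r S \<le> r * n" if "mod_ok m r n R S" for S
    using mod_norm_le[of r S "{..<n}"] that by (simp add: mod_ok_def is_struct_def)
  then show ?thesis unfolding RM_def by auto
qed

definition type_count :: "nat \<Rightarrow> nat \<Rightarrow> (nat \<Rightarrow> nat set) \<Rightarrow> nat set \<Rightarrow> nat" where
  "type_count r n R T = length (filter (\<lambda>a. {i. i < r \<and> a \<in> R i} = T) [0..<n])"

text \<open>Equal counts make the two lists of element types equal as multisets, so one list is a
  permutation of the other. The permuting map preserves types, and in a monadic vocabulary this
  makes it an isomorphism.\<close>

lemma structures_isomorphic:
  assumes "is_struct r n R" "is_struct r n R'"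
    and "\<And>T. T \<subseteq> {..<r} \<Longrightarrow> type_count r n R T = type_count r n R' T"
  obtains \<pi> where "\<pi> permutes {..<n}" "R' = (\<lambda>i. \<pi> ` R i)"
proof -
  define t where "t R a = {i. i < r \<and> a \<in> R i}" for R and a :: nat
  have "count (mset (map (t R) [0..<n])) T = count (mset (map (t R') [0..<n])) T" for T
  proof (cases "T \<subseteq> {..<r}")
    case True
    have "count (mset (map (t R) [0..<n])) T = type_count r n R T" for R
      unfolding type_count_def t_def[symmetric]
      by (simp only: count_mset count_list_eq_length_filter filter_map length_map comp_def
          eq_commute[of T])
    then show ?thesis using assms(3)[OF True] by metis
  next
    case False
    then have "T \<notin> set (map (t R) [0..<n])" for R by (auto simp: t_def)
    then show ?thesis by (metis count_mset_0_iff)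
  qed
  then have "mset (map (t R) [0..<n]) = mset (map (t R') [0..<n])" by (rule multiset_eqI)
  then obtain \<pi> where \<pi>: "\<pi> permutes {..<n}"
    "permute_list \<pi> (map (t R') [0..<n]) = map (t R) [0..<n]"
    by (elim mset_eq_permutation) (simp only: length_map length_upt diff_zero)
  have type: "t R' (\<pi> a) = t R a" if "a < n" for a
  proof -
    have "permute_list \<pi> (map (t R') [0..<n]) ! a = map (t R') [0..<n] ! \<pi> a"
      using \<pi>(1) that by (intro permute_list_nth) auto
    moreover have "\<pi> a < n" using permutes_in_image[OF \<pi>(1), of a] that by simp
    ultimately show ?thesis using \<pi>(2) that by simp
  qed
  have "R' i = \<pi> ` R i" for i
  proof (cases "i < r")
    case True
    then have sub: "R i \<subseteq> {..<n}" "R' i \<subseteq> {..<n}" using assms(1,2) by (auto simp: is_struct_def)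
    have mem: "\<pi> a \<in> R' i \<longleftrightarrow> a \<in> R i" if "a < n" for a
      using type[OF that] True by (auto simp: t_def)
    show ?thesis
    proof (intro equalityI subsetI)
      fix b assume b: "b \<in> R' i"
      then have "b \<in> \<pi> ` {..<n}" using sub permutes_image[OF \<pi>(1)] by auto
      then show "b \<in> \<pi> ` R i" using mem b by auto
    qed (use sub mem in auto)
  next
    case False
    then show ?thesis using assms(1,2) by (simp add: is_struct_def)
  qed
  then show thesis using that[OF \<pi>(1)] by blast
qed

section \<open>Type counts and budget as features of the input\<close>

definition type_circ :: "nat \<Rightarrow> nat \<Rightarrow> nat list \<Rightarrow> nat \<Rightarrow> circ" where
  "type_circ r n T a =
     AndG (map (\<lambda>i. if i \<in> set T then Inp (i * n + a) else NotG (Inp (i * n + a))) [0..<r])"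

text \<open>The first list reads the unary budget, so its count is the capped budget; each further
  list counts the elements of one type. There are \<open>2 ^ r + 1\<close> lists, a
  constant.\<close>

definition features :: "nat \<Rightarrow> nat \<Rightarrow> circ list list" where
  "features r n = map Inp [r * n..<2 * (r * n)] #
     map (\<lambda>T. map (type_circ r n T) [0..<n]) (subseqs [0..<r])"

lemma ceval_type_circ:
  assumes "a < n" "set T \<subseteq> {..<r}"
  shows "ceval (enc r n R k) (type_circ r n T a) \<longleftrightarrow> {i. i < r \<and> a \<in> R i} = set T"
proof -
  have "ceval (enc r n R k) (type_circ r n T a) \<longleftrightarrow> (\<forall>i<r. a \<in> R i \<longleftrightarrow> i \<in> set T)"
    using assms(1) by (auto simp: type_circ_def list_all_iff enc_rel)
  then show ?thesis using assms(2) by auto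
qed

lemma counts_features:
  "counts (enc r n R k) (features r n) =
     min k (r * n) # map (\<lambda>T. type_count r n R (set T)) (subseqs [0..<r])"
proof -
  have "length (filter (\<lambda>j. enc r n R k j) [r * n..<2 * (r * n)]) = min k (r * n)"
  proof -
    have "length (filter (\<lambda>j. enc r n R k j) [r * n..<2 * (r * n)]) =
        card {j. enc r n R k j \<and> r * n \<le> j \<and> j < 2 * (r * n)}"
      by (subst distinct_card[symmetric]) (auto intro: arg_cong[where f = card])
    also have "{j. enc r n R k j \<and> r * n \<le> j \<and> j < 2 * (r * n)} =
        (\<lambda>j. r * n + j) ` {..<min k (r * n)}"
    proof -
      have "j \<in> (\<lambda>j. r * n + j) ` {..<min k (r * n)}"
        if "enc r n R k j" "r * n \<le> j" "j < 2 * (r * n)" for j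
        using that by (intro image_eqI[of _ _ "j - r * n"]) (auto simp: enc_def split: if_splits)
      moreover have "(\<lambda>j. r * n + j) ` {..<min k (r * n)} \<subseteq>
          {j. enc r n R k j \<and> r * n \<le> j \<and> j < 2 * (r * n)}"
        by (intro image_subsetI) (simp only: enc_budget mem_Collect_eq lessThan_iff, linarith)
      ultimately show ?thesis by blast
    qed
    also have "card \<dots> = min k (r * n)" by (simp add: card_image)
    finally show ?thesis .
  qed
  moreover have "length (filter (ceval (enc r n R k)) (map (type_circ r n T) [0..<n])) =
      type_count r n R (set T)" if "T \<in> set (subseqs [0..<r])" for T
  proof -
    have "set T \<subseteq> {..<r}" using imageI[OF that, of set] unfolding subseqs_powset by auto
    then have "filter (\<lambda>a. ceval (enc r n R k) (type_circ r n T a)) [0..<n] =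
        filter (\<lambda>a. {i. i < r \<and> a \<in> R i} = set T) [0..<n]"
      by (intro filter_cong refl ceval_type_circ) auto
    then show ?thesis by (simp add: type_count_def filter_map comp_def)
  qed
  ultimately show ?thesis by (simp add: counts_def features_def filter_map comp_def)
qed

lemma RM_depends_on_counts:
  assumes sent: "is_sentence r qs \<psi>"
    and R: "is_struct r n R" "is_struct r n R'"
    and eq: "counts (enc r n R k) (features r n) = counts (enc r n R' k') (features r n)"
    and RM: "RM m r qs \<psi> n R k"
  shows "RM m r qs \<psi> n R' k'"
proof -
  have k: "min k (r * n) = min k' (r * n)" and
    types: "\<And>T. T \<in> set (subseqs [0..<r]) \<Longrightarrow> type_count r n R (set T) = type_count r n R' (set T)"
    using eq unfolding counts_features by auto
  have "type_count r n R T = type_count r n R' T" if "T \<subseteq> {..<r}" for T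
    using types subset_subseqs[of T "[0..<r]"] that by (auto simp: atLeast0LessThan)
  then obtain \<pi> where "\<pi> permutes {..<n}" "R' = (\<lambda>i. \<pi> ` R i)"
    using structures_isomorphic[OF R] by metis
  then have "RM m r qs \<psi> n R' k" using RM_permutes[OF sent _ RM] by simp
  then show ?thesis using RM_min k by metis
qed

theorem RM_in_TC0:
  assumes sent: "is_sentence r qs \<psi>"
  shows "in_TC0 r (RM m r qs \<psi>)"
proof -
  \<comment> \<open>Again acceptance means that some instance with these counts is positive;
    \<open>RM_depends_on_counts\<close> makes the choice of instance immaterial.\<close>
  define g where "g n v \<longleftrightarrow> (\<exists>R k. is_struct r n R \<and>
      v = counts (enc r n R k) (features r n) \<and> RM m r qs \<psi> n R k)" for n v
  define M where "M n = (r + 1) * n" for n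
  define C where "C n = counting (features r n) (M n) (g n)" for n
  define L where "L = Suc (2 ^ r :: nat)"
  have len: "length cs \<le> M n" if "cs \<in> set (features r n)" for cs n
    using that by (auto simp: features_def M_def)
  have circ: "cdepth c \<le> 2" "csize c \<le> 1 + r * 2"
    if "cs \<in> set (features r n)" "c \<in> set cs" for cs c n
  proof -
    have "csize (type_circ r n T a) \<le> Suc (length [0..<r] * 2)" for T a
      unfolding type_circ_def csize.simps map_map comp_def
      by (intro Suc_le_mono[THEN iffD2] sum_list_map_le) auto
    moreover have "cdepth (type_circ r n T a) \<le> 2" for T a
      by (auto simp: type_circ_def foldr_max_le_iff numeral_2_eq_2)
    ultimately show "cdepth c \<le> 2" "csize c \<le> 1 + r * 2"
      using that by (auto simp: features_def)
  qed
  have lenF: "length (features r n) = L" for n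
    by (simp add: features_def length_subseqs L_def)
  show ?thesis
    unfolding in_TC0_def
  proof (rule decided_by_cd_circuitsI[where C = C and d = 7 and
        s = "\<lambda>n. 1 + (1 + (r + 1) * n) ^ L * (1 + L * (4 + 2 * (((r + 1) * n) * (1 + r * 2))))"])
    show "poly_bounded
        (\<lambda>n. 1 + (1 + (r + 1) * n) ^ L * (1 + L * (4 + 2 * (((r + 1) * n) * (1 + r * 2)))))"
      by (intro poly_bounded_intros)
  next
    fix n
    show "cdepth (C n) \<le> 7"
      using cdepth_counting[of "features r n" 2] circ(1) by (simp add: C_def)
    show "csize (C n) \<le>
        1 + (1 + (r + 1) * n) ^ L * (1 + L * (4 + 2 * (((r + 1) * n) * (1 + r * 2))))"
      using csize_counting[of "features r n" "M n" "1 + r * 2" "g n"] len circ(2)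
      unfolding lenF C_def M_def by auto
    show "True \<or> no_thr (C n)" by simp
    fix R k assume R: "is_struct r n R"
    have "ceval (enc r n R k) (C n) \<longleftrightarrow> g n (counts (enc r n R k) (features r n))"
      unfolding C_def using len by (intro ceval_counting)
    also have "\<dots> \<longleftrightarrow> RM m r qs \<psi> n R k"
      unfolding g_def using RM_depends_on_counts[OF sent _ R] R by metis
    finally show "ceval (enc r n R k) (C n) = RM m r qs \<psi> n R k" .
  qed
qed

section \<open>Functions of low degree over the field with three elements\<close>

text \<open>Squaring turns a value modulo 3 into the 0/1 indicator of being nonzero, at the price of
  doubling the degree.\<close>

lemma square_eq_one_if_nonzero: "x * x = 1" if "x \<noteq> 0" for x :: 3
  using that
proof (induct x)
  case (of_int z)
  then have "z = 0 \<or> z = 1 \<or> z = 2" by auto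
  then show ?case using of_int by auto
qed

text \<open>The character of \<open>S\<close> on the group of subsets under symmetric difference;
  equivalently, the multilinear monomial over \<open>S\<close> in variables with values 1 and -1.
  The full set gives parity.\<close>

definition chi :: "nat set \<Rightarrow> nat set \<Rightarrow> 3" where
  "chi S X = (- 1) ^ card (S \<inter> X)"

text \<open>Elements of \<open>S \<inter> T \<inter> X\<close> are counted twice in the exponent and
  so contribute the factor 1.\<close>

lemma chi_mult:
  assumes "finite S" "finite T"
  shows "chi S X * chi T X = chi ((S - T) \<union> (T - S)) X"
proof -
  have split: "card (A \<inter> X) = card ((A - B) \<inter> X) + card (A \<inter> B \<inter> X)" if "finite A" for A B :: "nat set"
    using that by (subst card_Un_disjoint[symmetric]) (auto intro: arg_cong[where f = card])
  have "card (((S - T) \<union> (T - S)) \<inter> X) = card ((S - T) \<inter> X) + card ((T - S) \<inter> X)"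
    using assms by (subst card_Un_disjoint[symmetric]) (auto intro: arg_cong[where f = card])
  then have "card (S \<inter> X) + card (T \<inter> X) =
      card (((S - T) \<union> (T - S)) \<inter> X) + 2 * card (S \<inter> T \<inter> X)"
    using split[OF assms(1), of T] split[OF assms(2), of S] by (simp add: Int_commute)
  then show ?thesis
    unfolding chi_def power_add[symmetric] by (simp add: power_add)
qed

definition low :: "nat \<Rightarrow> nat \<Rightarrow> nat set set" where
  "low n D = {S. S \<subseteq> {..<n} \<and> card S \<le> D}"

text \<open>Polynomials of degree at most \<open>D\<close> in the variables with values 1 and -1,
  taken as functions. In this basis they are multilinear from the outset.\<close>

definition lowdeg :: "nat \<Rightarrow> nat \<Rightarrow> (nat set \<Rightarrow> 3) \<Rightarrow> bool" where
  "lowdeg n D f \<longleftrightarrow> (\<exists>c. \<forall>X. f X = (\<Sum>S\<in>low n D. c S * chi S X))"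

lemma finite_low: "finite (low n D)"
  unfolding low_def by (rule finite_subset[of _ "Pow {..<n}"]) auto

lemma lowdeg_chi: "S \<in> low n D \<Longrightarrow> lowdeg n D (chi S)"
  unfolding lowdeg_def
  by (rule exI[of _ "\<lambda>T. if T = S then 1 else 0"])
    (simp add: if_distrib[of "\<lambda>x. x * _"] finite_low cong: if_cong)

lemma lowdeg_add:
  assumes "lowdeg n D f" "lowdeg n D g"
  shows "lowdeg n D (\<lambda>X. f X + g X)"
proof -
  obtain c d where "\<And>X. f X = (\<Sum>S\<in>low n D. c S * chi S X)" "\<And>X. g X = (\<Sum>S\<in>low n D. d S * chi S X)"
    using assms unfolding lowdeg_def by auto
  then show ?thesis
    unfolding lowdeg_def
    by (intro exI[of _ "\<lambda>S. c S + d S"]) (simp add: sum.distrib distrib_right)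
qed

lemma lowdeg_scale:
  assumes "lowdeg n D f"
  shows "lowdeg n D (\<lambda>X. a * f X)"
proof -
  obtain c where "\<And>X. f X = (\<Sum>S\<in>low n D. c S * chi S X)"
    using assms unfolding lowdeg_def by auto
  then show ?thesis
    unfolding lowdeg_def
    by (intro exI[of _ "\<lambda>S. a * c S"]) (simp add: sum_distrib_left mult.assoc)
qed

lemma lowdeg_const: "lowdeg n D (\<lambda>_. a)"
proof -
  have "lowdeg n D (chi {})" by (rule lowdeg_chi) (simp add: low_def)
  from lowdeg_scale[OF this, of a] show ?thesis by (simp add: chi_def)
qed

lemma lowdeg_diff:
  assumes "lowdeg n D f" "lowdeg n D g"
  shows "lowdeg n D (\<lambda>X. f X - g X)"
  using lowdeg_add[OF assms(1) lowdeg_scale[OF assms(2), of "- 1"]] by simp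

lemma lowdeg_sum:
  assumes "\<And>i. i \<in> I \<Longrightarrow> lowdeg n D (f i)"
  shows "lowdeg n D (\<lambda>X. \<Sum>i\<in>I. f i X)"
  using assms
  by (induction I rule: infinite_finite_induct) (simp_all add: lowdeg_const lowdeg_add)

lemma lowdeg_mono:
  assumes "lowdeg n D f" "D \<le> D'"
  shows "lowdeg n D' f"
proof -
  obtain c where c: "\<And>X. f X = (\<Sum>S\<in>low n D. c S * chi S X)"
    using assms unfolding lowdeg_def by auto
  have "lowdeg n D' (\<lambda>X. \<Sum>S\<in>low n D. c S * chi S X)"
    using assms(2) by (intro lowdeg_sum lowdeg_scale lowdeg_chi) (auto simp: low_def)
  then show ?thesis using c by (simp add: lowdeg_def)
qed

text \<open>A product of characters is the character of the symmetric difference, whose size is at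
  most the sum of the two sizes.\<close>

lemma lowdeg_mult:
  assumes "lowdeg n D f" "lowdeg n E g"
  shows "lowdeg n (D + E) (\<lambda>X. f X * g X)"
proof -
  obtain c d where c: "\<And>X. f X = (\<Sum>S\<in>low n D. c S * chi S X)"
    and d: "\<And>X. g X = (\<Sum>S\<in>low n E. d S * chi S X)"
    using assms unfolding lowdeg_def by auto
  have fin: "finite S" if "S \<in> low n D'" for S D'
    using that unfolding low_def by (auto intro: finite_subset)
  have "f X * g X =
      (\<Sum>S\<in>low n D. \<Sum>T\<in>low n E. (c S * d T) * chi ((S - T) \<union> (T - S)) X)" for X
    unfolding c d sum_product
  proof (intro sum.cong refl)
    fix S T assume "S \<in> low n D" "T \<in> low n E"
    then show "c S * chi S X * (d T * chi T X) = c S * d T * chi (S - T \<union> (T - S)) X"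
      using chi_mult[OF fin fin, of S D T E X] by (metis mult.assoc mult.left_commute)
  qed
  moreover have "lowdeg n (D + E)
      (\<lambda>X. \<Sum>S\<in>low n D. \<Sum>T\<in>low n E. (c S * d T) * chi ((S - T) \<union> (T - S)) X)"
  proof (intro lowdeg_sum lowdeg_scale lowdeg_chi)
    fix S T assume ST: "S \<in> low n D" "T \<in> low n E"
    have "card ((S - T) \<union> (T - S)) \<le> card (S \<union> T)"
      using ST fin by (intro card_mono) auto
    also have "\<dots> \<le> card S + card T" by (rule card_Un_le)
    finally show "(S - T) \<union> (T - S) \<in> low n (D + E)" using ST by (auto simp: low_def)
  qed
  ultimately show ?thesis by (simp add: lowdeg_def)
qed

lemma lowdeg_prod_list:
  assumes "\<And>t. t \<in> set ts \<Longrightarrow> lowdeg n D (f t)"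
  shows "lowdeg n (length ts * D) (\<lambda>X. \<Prod>t\<leftarrow>ts. f t X)"
  using assms by (induction ts) (simp_all add: lowdeg_const lowdeg_mult)

text \<open>Modulo 3 the character of a singleton gives the bit by a shift: \<open>1 - 1 = 0\<close>
  and \<open>-1 - 1 = 1\<close>.\<close>

lemma lowdeg_input:
  assumes "i < n" "1 \<le> D"
  shows "lowdeg n D (\<lambda>X. of_bool (i \<in> X))"
proof -
  have "of_bool (i \<in> X) = chi {i} X - 1" for X by (simp add: chi_def)
  moreover have "lowdeg n D (\<lambda>X. chi {i} X - 1)"
    using assms by (intro lowdeg_diff lowdeg_chi lowdeg_const) (simp add: low_def)
  ultimately show ?thesis by simp
qed

text \<open>The indicator of a single point is a product of \<open>n\<close> factors of degree 1;
  every function on the cube is a combination of such indicators.\<close>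

lemma lowdeg_interpolation:
  "\<exists>f. lowdeg n n f \<and> (\<forall>X\<subseteq>{..<n}. f X = h X)"
proof -
  define delta where "delta Y X =
      (\<Prod>i\<leftarrow>[0..<n]. if i \<in> Y then of_bool (i \<in> X) else 1 - of_bool (i \<in> X) :: 3)" for X Y
  have "lowdeg n (length [0..<n] * 1) (delta Y)" for Y
    unfolding delta_def
  proof (rule lowdeg_prod_list)
    fix i assume "i \<in> set [0..<n]"
    then show "lowdeg n 1 (\<lambda>X. if i \<in> Y then of_bool (i \<in> X) else 1 - of_bool (i \<in> X))"
      by (cases "i \<in> Y") (simp_all add: lowdeg_input lowdeg_diff lowdeg_const)
  qed
  then have deg: "lowdeg n n (delta Y)" for Y by simp
  have delta: "delta Y X = of_bool (X = Y)" if "X \<subseteq> {..<n}" "Y \<subseteq> {..<n}" for X Y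
  proof (cases "X = Y")
    case True
    have "(\<Prod>i\<leftarrow>xs. if i \<in> Y then of_bool (i \<in> Y) else 1 - of_bool (i \<in> Y) :: 3) = 1" for xs
      by (induction xs) auto
    then show ?thesis using True by (simp add: delta_def)
  next
    case False
    then obtain i where "i \<in> X \<longleftrightarrow> i \<notin> Y" by blast
    moreover from this have "i < n" using that by blast
    ultimately have "0 \<in> set (map (\<lambda>i. if i \<in> Y then of_bool (i \<in> X) else 1 - of_bool (i \<in> X) :: 3) [0..<n])"
      by (auto intro!: image_eqI[of _ _ i])
    moreover have "prod_list xs = 0" if "0 \<in> set xs" for xs :: "3 list"
      using that by (induction xs) auto
    ultimately show ?thesis using False by (simp add: delta_def)
  qed
  define f where "f X = (\<Sum>Y\<in>Pow {..<n}. h Y * delta Y X)" for X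
  have "lowdeg n n f"
    unfolding f_def by (intro lowdeg_sum lowdeg_scale deg)
  moreover have "f X = h X" if "X \<subseteq> {..<n}" for X
  proof -
    have "f X = (\<Sum>Y\<in>Pow {..<n}. if Y = X then h Y else 0)"
      unfolding f_def using that by (intro sum.cong) (auto simp: delta)
    then show ?thesis using that by simp
  qed
  ultimately show ?thesis by blast
qed

text \<open>On \<open>G\<close> a character of a set with more than \<open>m\<close> elements is \<open>g\<close> times the character of the
  complement, so every function on \<open>G\<close> has degree at most \<open>m + D\<close>; count these functions.\<close>
lemma card_le_if_parity_lowdeg:
  assumes g: "lowdeg (2 * m) D g" and G: "G \<subseteq> Pow {..<2 * m}"
    and parity: "\<And>X. X \<in> G \<Longrightarrow> g X = chi {..<2 * m} X"
  shows "card G \<le> card (low (2 * m) (m + D))"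
proof -
  define L where "L = low (2 * m) (m + D)"
  have finG: "finite G" using G finite_subset by blast
  have ext: "\<exists>c. \<forall>X\<in>G. h X = (\<Sum>S\<in>L. c S * chi S X)" for h
  proof -
    obtain h' where "lowdeg (2 * m) (2 * m) h'" and h': "\<And>X. X \<subseteq> {..<2 * m} \<Longrightarrow> h' X = h X"
      using lowdeg_interpolation by blast
    then obtain c where c: "\<And>X. h' X = (\<Sum>S\<in>low (2 * m) (2 * m). c S * chi S X)"
      unfolding lowdeg_def by blast
    \<comment> \<open>Characters of large sets are rewritten through the complement, which has fewer
      than \<open>m\<close> elements; multiplication by \<open>g\<close> then adds
      \<open>D\<close>.\<close>
    define f where "f X = (\<Sum>S\<in>low (2 * m) (2 * m).
        c S * (if card S \<le> m then chi S X else g X * chi ({..<2 * m} - S) X))" for X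
    have "lowdeg (2 * m) (m + D) f"
      unfolding f_def
    proof (intro lowdeg_sum lowdeg_scale)
      fix S assume S: "S \<in> low (2 * m) (2 * m)"
      show "lowdeg (2 * m) (m + D)
          (\<lambda>X. if card S \<le> m then chi S X else g X * chi ({..<2 * m} - S) X)"
      proof (cases "card S \<le> m")
        case True
        then show ?thesis using S by (auto intro!: lowdeg_chi simp: low_def)
      next
        case False
        have "card ({..<2 * m} - S) = 2 * m - card S"
          using S by (subst card_Diff_subset) (auto simp: low_def intro: finite_subset)
        then have "lowdeg (2 * m) m (chi ({..<2 * m} - S))"
          using False by (intro lowdeg_chi) (auto simp: low_def)
        from lowdeg_mult[OF g this] show ?thesis using False by (simp add: add.commute)
      qed
    qed
    then obtain c' where c': "\<And>X. f X = (\<Sum>S\<in>L. c' S * chi S X)"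
      unfolding lowdeg_def L_def by blast
    have "h X = f X" if "X \<in> G" for X
    proof -
      have "chi S X = g X * chi ({..<2 * m} - S) X" if "S \<in> low (2 * m) (2 * m)" for S
      proof -
        have "({..<2 * m} - ({..<2 * m} - S)) \<union> (({..<2 * m} - S) - {..<2 * m}) = S"
          using that by (auto simp: low_def)
        then show ?thesis
          using chi_mult[of "{..<2 * m}" "{..<2 * m} - S" X] parity[OF \<open>X \<in> G\<close>] by simp
      qed
      then have "f X = h' X" unfolding f_def c by (intro sum.cong) auto
      then show ?thesis using h' G that by auto
    qed
    then show ?thesis using c' by metis
  qed
  define ev where "ev c = restrict (\<lambda>X. \<Sum>S\<in>L. c S * chi S X) G" for c
  have finL: "finite L" unfolding L_def by (rule finite_low)
  \<comment> \<open>Coefficient vectors on \<open>L\<close> map onto all functions on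
    \<open>G\<close>, so \<open>3 ^ card G \<le> 3 ^ card L\<close>.\<close>
  have "(G \<rightarrow>\<^sub>E (UNIV :: 3 set)) \<subseteq> ev ` (L \<rightarrow>\<^sub>E UNIV)"
  proof
    fix h assume h: "h \<in> G \<rightarrow>\<^sub>E (UNIV :: 3 set)"
    obtain c where c: "\<And>X. X \<in> G \<Longrightarrow> h X = (\<Sum>S\<in>L. c S * chi S X)" using ext[of h] by blast
    have "h = ev (restrict c L)"
    proof
      fix X
      show "h X = ev (restrict c L) X"
        using h c by (cases "X \<in> G") (auto simp: ev_def intro!: sum.cong)
    qed
    then show "h \<in> ev ` (L \<rightarrow>\<^sub>E UNIV)" by auto
  qed
  then have "card (G \<rightarrow>\<^sub>E (UNIV :: 3 set)) \<le> card (L \<rightarrow>\<^sub>E (UNIV :: 3 set))"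
    using finL by (intro surj_card_le finite_PiE) auto
  then have "(3 :: nat) ^ card G \<le> 3 ^ card L"
    using finG finL by (simp add: card_funcsetE)
  then show ?thesis by (simp add: L_def)
qed

section \<open>Approximating circuits by functions of low degree\<close>

lemma zero_sum_subsets:
  fixes a :: "'i \<Rightarrow> 3"
  assumes "finite I" "i \<in> I" "a i \<noteq> 0"
  shows "2 * card {T \<in> Pow I. sum a T = 0} \<le> 2 ^ card I"
proof -
  define Z where "Z = {T \<in> Pow I. sum a T = 0}"
  \<comment> \<open>Toggling \<open>i\<close> changes the sum by \<open>a i\<close> or its negative,
    so zero sums are mapped injectively to nonzero ones.\<close>
  define flip where "flip T = (if i \<in> T then T - {i} else insert i T)" for T
  have "inj_on flip Z"
    unfolding inj_on_def flip_def by (auto split: if_splits) (blast+)?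
  then have "card (flip ` Z) = card Z" by (rule card_image)
  moreover have "flip ` Z \<subseteq> Pow I - Z"
  proof
    fix U assume "U \<in> flip ` Z"
    then obtain T where T: "T \<subseteq> I" "sum a T = 0" "U = flip T" by (auto simp: Z_def)
    have fin: "finite T" using T(1) assms(1) finite_subset by blast
    have "sum a U \<noteq> 0"
    proof (cases "i \<in> T")
      case True
      then have "sum a U = - a i" using T fin by (simp add: flip_def sum_diff1)
      then show ?thesis using assms(3) by simp
    next
      case False
      then show ?thesis using T fin assms(3) by (simp add: flip_def)
    qed
    then show "U \<in> Pow I - Z" using T assms(2) by (auto simp: Z_def flip_def)
  qed
  ultimately have "card Z \<le> card (Pow I - Z)"
    using assms(1) by (metis card_mono finite_Diff finite_Pow_iff)
  moreover have "card (Pow I - Z) = 2 ^ card I - card Z"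
    using assms(1) by (subst card_Diff_subset) (auto simp: Z_def card_Pow)
  moreover have "card Z \<le> 2 ^ card I"
    using card_mono[of "Pow I" Z] assms(1) by (auto simp: Z_def card_Pow)
  ultimately show ?thesis unfolding Z_def by linarith
qed

text \<open>Averaging: every point of \<open>B\<close> is missed by at most half of all subsets of
  \<open>I\<close>, so by double counting some subset misses at most half of
  \<open>B\<close>.\<close>

lemma exists_halving_subset:
  fixes p :: "'i \<Rightarrow> 'x \<Rightarrow> 3"
  assumes "finite I" "finite B" "\<And>X. X \<in> B \<Longrightarrow> \<exists>i\<in>I. p i X \<noteq> 0"
  shows "\<exists>T\<subseteq>I. 2 * card {X \<in> B. (\<Sum>i\<in>T. p i X) = 0} \<le> card B"
proof (rule ccontr)
  assume "\<not> ?thesis"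
  then have gt: "\<And>T. T \<subseteq> I \<Longrightarrow> card B < 2 * card {X \<in> B. (\<Sum>i\<in>T. p i X) = 0}"
    by (meson not_le)
  have card: "card {x \<in> A. Q x} = (\<Sum>x\<in>A. if Q x then 1 else 0)" if "finite A" for A and Q :: "'b \<Rightarrow> bool"
    using that by (simp add: sum.If_cases Int_def)
  have "(\<Sum>T\<in>Pow I. card B) < (\<Sum>T\<in>Pow I. 2 * card {X \<in> B. (\<Sum>i\<in>T. p i X) = 0})"
    using assms(1) gt by (intro sum_strict_mono) auto
  also have "\<dots> = (\<Sum>X\<in>B. 2 * card {T \<in> Pow I. (\<Sum>i\<in>T. p i X) = 0})"
    unfolding card[OF assms(2)] card[OF finite_Pow_iff[THEN iffD2, OF assms(1)]]
      sum_distrib_left[symmetric] by (subst sum.swap) (rule refl)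
  also have "\<dots> \<le> (\<Sum>X\<in>B. 2 ^ card I)"
  proof (rule sum_mono)
    fix X assume "X \<in> B"
    then obtain i where "i \<in> I" "p i X \<noteq> 0" using assms(3) by blast
    then show "2 * card {T \<in> Pow I. (\<Sum>i\<in>T. p i X) = 0} \<le> 2 ^ card I"
      by (rule zero_sum_subsets[OF assms(1)])
  qed
  finally show False using assms(1) by (simp add: card_Pow mult.commute)
qed

text \<open>The halving is repeated on the points that all earlier subsets have missed.\<close>

lemma exists_halving_subsets:
  fixes p :: "'i \<Rightarrow> 'x \<Rightarrow> 3"
  assumes "finite I" "finite B" "\<And>X. X \<in> B \<Longrightarrow> \<exists>i\<in>I. p i X \<noteq> 0"
  shows "\<exists>Ts. length Ts = l \<and> (\<forall>T\<in>set Ts. T \<subseteq> I) \<and>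
    card {X \<in> B. \<forall>T\<in>set Ts. (\<Sum>i\<in>T. p i X) = 0} * 2 ^ l \<le> card B"
proof (induction l)
  case (Suc l)
  then obtain Ts where Ts: "length Ts = l" "\<forall>T\<in>set Ts. T \<subseteq> I"
    "card {X \<in> B. \<forall>T\<in>set Ts. (\<Sum>i\<in>T. p i X) = 0} * 2 ^ l \<le> card B" by blast
  define B' where "B' = {X \<in> B. \<forall>T\<in>set Ts. (\<Sum>i\<in>T. p i X) = 0}"
  have "finite B'" "\<And>X. X \<in> B' \<Longrightarrow> \<exists>i\<in>I. p i X \<noteq> 0"
    using assms by (auto simp: B'_def)
  then have "\<exists>T\<subseteq>I. 2 * card {X \<in> B'. (\<Sum>i\<in>T. p i X) = 0} \<le> card B'"
    by (rule exists_halving_subset[OF assms(1)])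
  then obtain T where T: "T \<subseteq> I" "2 * card {X \<in> B'. (\<Sum>i\<in>T. p i X) = 0} \<le> card B'"
    by (elim exE conjE)
  have "{X \<in> B. \<forall>U\<in>set (T # Ts). (\<Sum>i\<in>U. p i X) = 0} = {X \<in> B'. (\<Sum>i\<in>T. p i X) = 0}"
    unfolding B'_def list.set(2) by blast
  then have "card {X \<in> B. \<forall>U\<in>set (T # Ts). (\<Sum>i\<in>U. p i X) = 0} * 2 ^ Suc l \<le> card B' * 2 ^ l"
    using T(2) by simp
  also have "\<dots> \<le> card B" using Ts(3) by (simp add: B'_def)
  finally show ?case using Ts(1,2) T(1) by (intro exI[of _ "T # Ts"]) auto
qed (use card_mono[of B] assms(2) in \<open>auto intro!: exI[of _ "[]"]\<close>)

lemma lowdeg_or: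
  fixes p :: "'i \<Rightarrow> nat set \<Rightarrow> 3"
  assumes "finite I" "\<And>i. i \<in> I \<Longrightarrow> lowdeg n D (p i)"
  shows "\<exists>f. lowdeg n (2 * l * D) f \<and>
    card {X \<in> Pow {..<n}. f X \<noteq> of_bool (\<exists>i\<in>I. p i X \<noteq> 0)} * 2 ^ l \<le> 2 ^ n"
proof -
  define B where "B = {X \<in> Pow {..<n}. \<exists>i\<in>I. p i X \<noteq> 0}"
  have B: "finite B" "card B \<le> 2 ^ n"
    using card_mono[of "Pow {..<n}" B] by (auto simp: B_def card_Pow)
  obtain Ts where Ts: "length Ts = l" "\<And>T. T \<in> set Ts \<Longrightarrow> T \<subseteq> I"
    "card {X \<in> B. \<forall>T\<in>set Ts. (\<Sum>i\<in>T. p i X) = 0} * 2 ^ l \<le> card B"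
    using exists_halving_subsets[OF assms(1) B(1), of p l] unfolding B_def by blast
  \<comment> \<open>The exact disjunction of the \<open>l\<close> tests whether a subset sum is
    nonzero. Each factor has degree at most \<open>2 * D\<close>, whence the total
    \<open>2 * l * D\<close>.\<close>
  define f where "f X = 1 - (\<Prod>T\<leftarrow>Ts. 1 - (\<Sum>i\<in>T. p i X) * (\<Sum>i\<in>T. p i X))" for X
  have "lowdeg n (length Ts * (D + D)) (\<lambda>X. \<Prod>T\<leftarrow>Ts. 1 - (\<Sum>i\<in>T. p i X) * (\<Sum>i\<in>T. p i X))"
    using Ts(2) assms(2)
    by (intro lowdeg_prod_list lowdeg_diff lowdeg_const lowdeg_mult lowdeg_sum) blast+
  then have "lowdeg n (2 * l * D) f"
    unfolding f_def using Ts(1) by (intro lowdeg_diff lowdeg_const) (simp add: mult.assoc mult.left_commute flip: mult_2)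
  moreover have f: "f X = of_bool (\<exists>T\<in>set Ts. (\<Sum>i\<in>T. p i X) \<noteq> 0)" for X
  proof -
    have "1 - (\<Prod>t\<leftarrow>ts. 1 - a t * a t) = of_bool (\<exists>t\<in>set ts. a t \<noteq> 0)"
      for ts :: "'i set list" and a :: "'i set \<Rightarrow> 3"
    proof (induction ts)
      case (Cons t ts)
      then show ?case by (cases "a t = 0") (simp_all add: square_eq_one_if_nonzero)
    qed simp
    then show ?thesis unfolding f_def .
  qed
  \<comment> \<open>The error is one-sided: if all \<open>p i X\<close> vanish, then so do all
    subset sums. Errors thus occur only at points of \<open>B\<close> that every subset
    misses.\<close>
  have "{X \<in> Pow {..<n}. f X \<noteq> of_bool (\<exists>i\<in>I. p i X \<noteq> 0)} \<subseteq>
      {X \<in> B. \<forall>T\<in>set Ts. (\<Sum>i\<in>T. p i X) = 0}"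
  proof
    fix X assume X: "X \<in> {X \<in> Pow {..<n}. f X \<noteq> of_bool (\<exists>i\<in>I. p i X \<noteq> 0)}"
    have "\<exists>i\<in>I. p i X \<noteq> 0" if "T \<in> set Ts" "(\<Sum>i\<in>T. p i X) \<noteq> 0" for T
      using sum.neutral[of T "\<lambda>i. p i X"] that Ts(2)[OF that(1)] by blast
    then show "X \<in> {X \<in> B. \<forall>T\<in>set Ts. (\<Sum>i\<in>T. p i X) = 0}"
      using X unfolding f B_def by (auto simp: of_bool_def split: if_splits)
  qed
  then have "card {X \<in> Pow {..<n}. f X \<noteq> of_bool (\<exists>i\<in>I. p i X \<noteq> 0)} \<le>
      card {X \<in> B. \<forall>T\<in>set Ts. (\<Sum>i\<in>T. p i X) = 0}"
    using B(1) by (intro card_mono) auto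
  then have "card {X \<in> Pow {..<n}. f X \<noteq> of_bool (\<exists>i\<in>I. p i X \<noteq> 0)} * 2 ^ l \<le> 2 ^ n"
    using Ts(3) B(2) by (meson le_trans mult_le_mono1)
  ultimately show ?thesis by blast
qed

lemma sum_set_le_sum_list: "sum f (set xs) \<le> sum_list (map f xs)" for f :: "'a \<Rightarrow> nat"
  by (induction xs) (auto simp: sum.insert_if)

text \<open>The fraction of inputs in error is at most \<open>s / 2 ^ l\<close>; for circuits
  \<open>s\<close> is the size, each gate being charged \<open>1 / 2 ^ l\<close>.\<close>

definition approximable :: "nat \<Rightarrow> nat \<Rightarrow> nat \<Rightarrow> nat \<Rightarrow> (nat set \<Rightarrow> bool) \<Rightarrow> bool" where
  "approximable n l D s b \<longleftrightarrow> (\<exists>f. lowdeg n D f \<and>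
     card {X \<in> Pow {..<n}. f X \<noteq> of_bool (b X)} * 2 ^ l \<le> s * 2 ^ n)"

lemma approximable_exact:
  assumes "lowdeg n D (\<lambda>X. of_bool (b X))"
  shows "approximable n l D s b"
  unfolding approximable_def using assms by (intro exI[of _ "\<lambda>X. of_bool (b X)"]) simp

lemma approximable_mono:
  assumes "approximable n l D s b" "D \<le> D'" "s \<le> s'"
  shows "approximable n l D' s' b"
proof -
  obtain f where f: "lowdeg n D f"
    "card {X \<in> Pow {..<n}. f X \<noteq> of_bool (b X)} * 2 ^ l \<le> s * 2 ^ n"
    using assms(1) unfolding approximable_def by blast
  note f(2)
  also have "s * 2 ^ n \<le> s' * 2 ^ n" using assms(3) by (rule mult_le_mono1)
  finally show ?thesis
    unfolding approximable_def using lowdeg_mono[OF f(1) assms(2)] by blast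
qed

lemma approximable_not:
  assumes "approximable n l D s b"
  shows "approximable n l D s (\<lambda>X. \<not> b X)"
proof -
  obtain f where f: "lowdeg n D f"
    "card {X \<in> Pow {..<n}. f X \<noteq> of_bool (b X)} * 2 ^ l \<le> s * 2 ^ n"
    using assms unfolding approximable_def by blast
  have "lowdeg n D (\<lambda>X. 1 - f X)" by (intro lowdeg_diff lowdeg_const f(1))
  moreover have "{X \<in> Pow {..<n}. 1 - f X \<noteq> of_bool (\<not> b X)} =
      {X \<in> Pow {..<n}. f X \<noteq> of_bool (b X)}"
    by (auto simp: of_bool_not_iff)
  ultimately show ?thesis
    unfolding approximable_def using f(2) by (intro exI[of _ "\<lambda>X. 1 - f X"]) (simp only: simp_thms)
qed

text \<open>Where no child errs and the approximate disjunction of the children does not err, the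
  result is right. A union bound adds the errors; the \<open>Suc\<close> pays for the new
  gate.\<close>

lemma approximable_ex:
  assumes "\<And>c. c \<in> set cs \<Longrightarrow> approximable n l D (s c) (b c)"
  shows "approximable n l (2 * l * D) (Suc (sum_list (map s cs))) (\<lambda>X. \<exists>c\<in>set cs. b c X)"
proof -
  have "\<forall>c\<in>set cs. \<exists>f. lowdeg n D f \<and>
      card {X \<in> Pow {..<n}. f X \<noteq> of_bool (b c X)} * 2 ^ l \<le> s c * 2 ^ n"
    using assms unfolding approximable_def by (rule ballI)
  from bchoice[OF this] obtain F where deg: "\<And>c. c \<in> set cs \<Longrightarrow> lowdeg n D (F c)"
    and err: "\<And>c. c \<in> set cs \<Longrightarrow>
      card {X \<in> Pow {..<n}. F c X \<noteq> of_bool (b c X)} * 2 ^ l \<le> s c * 2 ^ n"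
    by auto
  define E where "E c = {X \<in> Pow {..<n}. F c X \<noteq> of_bool (b c X)}" for c
  obtain f where f: "lowdeg n (2 * l * D) f"
    "card {X \<in> Pow {..<n}. f X \<noteq> of_bool (\<exists>c\<in>set cs. F c X \<noteq> 0)} * 2 ^ l \<le> 2 ^ n"
    using lowdeg_or[where I = "set cs" and p = F and l = l and D = D and n = n] deg by blast
  define E0 where "E0 = {X \<in> Pow {..<n}. f X \<noteq> of_bool (\<exists>c\<in>set cs. F c X \<noteq> 0)}"
  have "{X \<in> Pow {..<n}. f X \<noteq> of_bool (\<exists>c\<in>set cs. b c X)} \<subseteq> E0 \<union> (\<Union>c\<in>set cs. E c)"
  proof
    fix X assume X: "X \<in> {X \<in> Pow {..<n}. f X \<noteq> of_bool (\<exists>c\<in>set cs. b c X)}"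
    show "X \<in> E0 \<union> (\<Union>c\<in>set cs. E c)"
    proof (rule ccontr)
      assume "X \<notin> E0 \<union> (\<Union>c\<in>set cs. E c)"
      then have "\<And>c. c \<in> set cs \<Longrightarrow> F c X = of_bool (b c X)"
        and "f X = of_bool (\<exists>c\<in>set cs. F c X \<noteq> 0)"
        using X by (auto simp: E0_def E_def)
      moreover from this(1) have "(\<exists>c\<in>set cs. F c X \<noteq> 0) \<longleftrightarrow> (\<exists>c\<in>set cs. b c X)" by auto
      ultimately show False using X by simp
    qed
  qed
  then have "card {X \<in> Pow {..<n}. f X \<noteq> of_bool (\<exists>c\<in>set cs. b c X)} \<le>
      card (E0 \<union> (\<Union>c\<in>set cs. E c))"
    by (intro card_mono) (auto simp: E0_def E_def)
  also have "\<dots> \<le> card E0 + (\<Sum>c\<in>set cs. card (E c))"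
    using card_Un_le[of E0 "\<Union>c\<in>set cs. E c"] card_UN_le[of "set cs" E] by simp
  finally have "card {X \<in> Pow {..<n}. f X \<noteq> of_bool (\<exists>c\<in>set cs. b c X)} * 2 ^ l \<le>
      card E0 * 2 ^ l + (\<Sum>c\<in>set cs. card (E c) * 2 ^ l)"
    by (simp add: sum_distrib_right[symmetric] distrib_right[symmetric])
  also have "\<dots> \<le> 2 ^ n + (\<Sum>c\<in>set cs. s c * 2 ^ n)"
    using f(2) err by (intro add_mono sum_mono) (simp_all add: E0_def E_def)
  also have "\<dots> \<le> Suc (sum_list (map s cs)) * 2 ^ n"
    using sum_set_le_sum_list[of s cs] by (simp add: sum_distrib_right[symmetric])
  finally show ?thesis unfolding approximable_def using f(1) by blast
qed

text \<open>Each level multiplies the degree by at most \<open>2 * l\<close>, and the errors add up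
  to the size. Here \<open>x\<close> feeds the circuit from \<open>X\<close>, so some inputs may be
  constants.\<close>

lemma circuit_approximable:
  assumes "1 \<le> l" and inp: "\<And>j. lowdeg n 1 (\<lambda>X. of_bool (x X j))"
  shows "no_thr C \<Longrightarrow> approximable n l ((2 * l) ^ cdepth C) (csize C) (\<lambda>X. ceval (x X) C)"
proof (induction C)
  case (Inp j)
  show ?case using inp by (simp add: approximable_exact)
next
  case (Cst b)
  show ?case by (simp add: approximable_exact lowdeg_const)
next
  case (NotG C)
  then have "approximable n l ((2 * l) ^ cdepth C) (csize C) (\<lambda>X. \<not> ceval (x X) C)"
    by (intro approximable_not) simp
  then have "approximable n l ((2 * l) ^ cdepth (NotG C)) (csize (NotG C)) (\<lambda>X. \<not> ceval (x X) C)"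
    by (rule approximable_mono) (use assms(1) in auto)
  then show ?case by simp
next
  case (AndG cs)
  \<comment> \<open>By De Morgan, a conjunction is handled as the negation of a disjunction of
    negations.\<close>
  have "approximable n l (2 * l * (2 * l) ^ foldr max (map cdepth cs) 0)
      (Suc (sum_list (map csize cs))) (\<lambda>X. \<exists>c\<in>set cs. \<not> ceval (x X) c)"
  proof (intro approximable_ex approximable_not)
    fix c assume c: "c \<in> set cs"
    then have "no_thr c" using AndG.prems by (simp add: list_all_iff)
    from AndG.IH[OF c this]
    show "approximable n l ((2 * l) ^ foldr max (map cdepth cs) 0) (csize c) (\<lambda>X. ceval (x X) c)"
      by (rule approximable_mono[OF _ power_increasing])
        (use c assms(1) foldr_max_le_iff[of "map cdepth cs"] in auto)
  qed
  from approximable_not[OF this] show ?case by (simp add: list_all_iff mult.assoc)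
next
  case (OrG cs)
  have "approximable n l (2 * l * (2 * l) ^ foldr max (map cdepth cs) 0)
      (Suc (sum_list (map csize cs))) (\<lambda>X. \<exists>c\<in>set cs. ceval (x X) c)"
  proof (rule approximable_ex)
    fix c assume c: "c \<in> set cs"
    then have "no_thr c" using OrG.prems by (simp add: list_all_iff)
    from OrG.IH[OF c this]
    show "approximable n l ((2 * l) ^ foldr max (map cdepth cs) 0) (csize c) (\<lambda>X. ceval (x X) c)"
      by (rule approximable_mono[OF _ power_increasing])
        (use c assms(1) foldr_max_le_iff[of "map cdepth cs"] in auto)
  qed
  then show ?case by (simp add: list_ex_iff mult.assoc)
next
  case (ThrG t cs)
  then show ?case by simp
qed

section \<open>Counting is not in AC0\<close>

lemma central_binomial_square: "((2 * m) choose m) ^ 2 * (2 * m + 1) \<le> 16 ^ m"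
proof (induction m)
  case (Suc m)
  define b where "b = (2 * m) choose m"
  define b' where "b' = (2 * Suc m) choose Suc m"
  have "Suc m * b' = 2 * Suc m * ((2 * m + 1) choose m)"
    using Suc_times_binomial_eq[of "2 * m + 1" m] by (simp add: b'_def)
  then have "b' = 2 * ((2 * m + 1) choose m)"
    by (metis mult.assoc mult.left_commute mult_left_cancel nat.simps(3))
  moreover have "Suc m * ((2 * m + 1) choose Suc m) = (2 * m + 1) * b"
    using Suc_times_binomial_eq[of "2 * m" m] by (simp add: b_def)
  moreover have "(2 * m + 1) choose Suc m = (2 * m + 1) choose m"
    using binomial_symmetric[of m "2 * m + 1"] by simp
  ultimately have b': "Suc m * b' = 2 * (2 * m + 1) * b" by simp
  \<comment> \<open>The recurrence \<open>b'\<close> reduces the induction step to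
    \<open>(2 * m + 1) * (2 * m + 3) \<le> 4 * Suc m ^ 2\<close>.\<close>
  have "Suc m ^ 2 * (b' ^ 2 * (2 * Suc m + 1)) = (Suc m * b') ^ 2 * (2 * m + 3)"
  proof -
    have "2 * Suc m + 1 = 2 * m + 3" by simp
    then show ?thesis by (simp only: power_mult_distrib mult.assoc)
  qed
  also have "\<dots> = (b ^ 2 * (2 * m + 1)) * (4 * (2 * m + 1) * (2 * m + 3))"
    unfolding b' by (simp add: power2_eq_square algebra_simps)
  also have "\<dots> \<le> 16 ^ m * (16 * Suc m ^ 2)"
  proof (rule mult_le_mono)
    show "b ^ 2 * (2 * m + 1) \<le> 16 ^ m" using Suc.IH by (simp only: b_def)
  qed (simp add: power2_eq_square algebra_simps)
  also have "\<dots> = Suc m ^ 2 * 16 ^ Suc m" by simp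
  finally show ?case unfolding b'_def[symmetric] by (simp only: mult_le_cancel1) simp
qed simp

text \<open>By symmetry, the sets with fewer than \<open>m\<close> elements are at most half of all
  sets; each of the remaining \<open>D + 1\<close> layers is bounded by the central one.\<close>

lemma card_low_le: "2 * card (low (2 * m) (m + D)) \<le> 4 ^ m + 2 * (D + 1) * ((2 * m) choose m)"
proof -
  let ?b = "\<lambda>i. (2 * m) choose i"
  have "low (2 * m) (m + D) = (\<Union>i\<le>m + D. {S. S \<subseteq> {..<2 * m} \<and> card S = i})"
    by (auto simp: low_def)
  then have "card (low (2 * m) (m + D)) \<le> (\<Sum>i\<le>m + D. card {S. S \<subseteq> {..<2 * m} \<and> card S = i})"
    by (simp add: card_UN_le)
  also have "\<dots> = (\<Sum>i\<le>m + D. ?b i)" by (simp add: n_subsets)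
  also have "\<dots> = (\<Sum>i<m. ?b i) + (\<Sum>i\<in>{m..m + D}. ?b i)"
    by (subst sum.union_disjoint[symmetric]) (auto intro!: sum.cong)
  also have "(\<Sum>i\<in>{m..m + D}. ?b i) \<le> (\<Sum>i\<in>{m..m + D}. ?b m)"
    by (intro sum_mono binomial_maximum')
  finally have "card (low (2 * m) (m + D)) \<le> (\<Sum>i<m. ?b i) + (D + 1) * ?b m" by simp
  moreover have "2 * (\<Sum>i<m. ?b i) \<le> 4 ^ m"
  proof -
    have "(\<Sum>i<m. ?b i) = (\<Sum>i<m. ?b (2 * m - i))"
      by (intro sum.cong refl binomial_symmetric) auto
    also have "\<dots> = (\<Sum>i\<in>(\<lambda>i. 2 * m - i) ` {..<m}. ?b i)"
      by (subst sum.reindex) (auto simp: inj_on_def)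
    finally have "2 * (\<Sum>i<m. ?b i) = (\<Sum>i<m. ?b i) + (\<Sum>i\<in>(\<lambda>i. 2 * m - i) ` {..<m}. ?b i)" by simp
    also have "\<dots> = (\<Sum>i\<in>{..<m} \<union> (\<lambda>i. 2 * m - i) ` {..<m}. ?b i)"
      by (subst sum.union_disjoint) auto
    also have "\<dots> \<le> (\<Sum>i\<le>2 * m. ?b i)" by (intro sum_mono2) auto
    also have "\<dots> = 4 ^ m" by (simp add: choose_row_sum power_mult)
    finally show ?thesis .
  qed
  ultimately show ?thesis by (simp add: algebra_simps)
qed

text \<open>For \<open>w \<le> n\<close>, one of the two alternating sums is \<open>(-1) ^ w\<close>
  and the other is 0, depending on the parity of \<open>n - w\<close>. Adding them recovers the sign
  from the thresholds.\<close>

lemma alternating_threshold_sum: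
  "(\<Sum>k\<le>n. (- 1) ^ k * of_bool (w \<le> k)) + (\<Sum>k<n. (- 1) ^ k * of_bool (w \<le> k)) =
    (if w \<le> n then (- 1) ^ w else 0 :: 'a :: comm_ring_1)"
proof (induction n)
  case (Suc n)
  have "(\<Sum>k\<le>Suc n. (- 1) ^ k * of_bool (w \<le> k)) + (\<Sum>k<Suc n. (- 1) ^ k * of_bool (w \<le> k)) =
      (if w \<le> n then (- 1) ^ w else 0 :: 'a) + (- 1) ^ Suc n * of_bool (w \<le> Suc n) +
      (- 1) ^ n * of_bool (w \<le> n)"
    unfolding Suc[symmetric] by (simp add: algebra_simps)
  also have "\<dots> = (if w \<le> Suc n then (- 1) ^ w else 0)"
    by (cases "w = Suc n") auto
  finally show ?case .
qed auto

text \<open>Supplies \<open>t\<close> for the lower bound: with \<open>n = 4 ^ t\<close> the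
  approximation degree is polynomial in \<open>t\<close>, whereas the square root of
  \<open>n\<close> is \<open>2 ^ t\<close>.\<close>

lemma polynomial_less_power_two:
  "\<exists>t\<ge>1. 4 * ((2 * (2 * (t + 1) * (c + 1) + 3)) ^ d + 1) \<le> (2 :: nat) ^ t"
proof -
  have "eventually (\<lambda>t::nat. 4 * ((2 * (2 * (real t + 1) * (real c + 1) + 3)) ^ d + 1) \<le> 2 ^ t) at_top"
    by real_asymp
  then obtain t0 where "\<And>t. t \<ge> t0 \<Longrightarrow> 4 * ((2 * (2 * (real t + 1) * (real c + 1) + 3)) ^ d + 1) \<le> 2 ^ t"
    unfolding eventually_sequentially by blast
  then obtain t where t: "t \<ge> 1" "4 * ((2 * (2 * (real t + 1) * (real c + 1) + 3)) ^ d + 1) \<le> 2 ^ t"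
    by (meson max.cobounded1 max.cobounded2)
  have "real (4 * ((2 * (2 * (t + 1) * (c + 1) + 3)) ^ d + 1)) \<le> real (2 ^ t)"
    using t(2) by (simp only: of_nat_mult of_nat_add of_nat_power of_nat_numeral of_nat_1)
  then show ?thesis using t(1) of_nat_le_iff by blast
qed

text \<open>The weight \<open>w\<close> stands for the number of elements inside or outside a
  relation. For even \<open>n\<close> both have the same parity, so one argument covers deletion and
  addition. The condition \<open>n > 0\<close> accommodates quantifiers over an empty
  universe.\<close>

theorem counting_notin_AC0:
  assumes P: "\<And>n R k. n > 0 \<Longrightarrow> is_struct 1 n R \<Longrightarrow> P n R k \<longleftrightarrow> w n (R 0) \<le> k"
    and w: "\<And>n X. X \<subseteq> {..<n} \<Longrightarrow> even n \<Longrightarrow> w n X \<le> n \<and> (even (w n X) \<longleftrightarrow> even (card X))"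
  shows "\<not> in_AC0 1 P"
proof
  assume "in_AC0 1 P"
  then obtain d c where circ: "\<And>n. \<exists>C. cdepth C \<le> d \<and> csize C \<le> (n + 2) ^ c \<and> no_thr C \<and>
      (\<forall>R k. is_struct 1 n R \<longrightarrow> ceval (enc 1 n R k) C = P n R k)"
    unfolding in_AC0_def decided_by_cd_circuits_def by auto
  obtain t where t: "t \<ge> 1" "4 * ((2 * (2 * (t + 1) * (c + 1) + 3)) ^ d + 1) \<le> (2 :: nat) ^ t"
    using polynomial_less_power_two by blast
  \<comment> \<open>Chosen so that \<open>8 * (n + 2) ^ (c + 1) \<le> 2 ^ l\<close>; the errors of
    all \<open>n + 1\<close> thresholds together then cover at most one eighth of the
    inputs.\<close>
  define l where "l = 2 * (t + 1) * (c + 1) + 3"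
  define D where "D = (2 * l) ^ d"
  define n where "n = (4 :: nat) ^ t"
  define m where "m = 2 * (4 :: nat) ^ (t - 1)"
  have n: "n = 2 * m" "n > 0"
    using t(1) by (cases t; simp add: n_def m_def)+
  obtain C where C: "cdepth C \<le> d" "csize C \<le> (n + 2) ^ c" "no_thr C"
    "\<And>R k. is_struct 1 n R \<Longrightarrow> ceval (enc 1 n R k) C = P n R k"
    using circ by blast
  define str where "str X = (\<lambda>i :: nat. if i = 0 then X else {})" for X :: "nat set"
  have str: "is_struct 1 n (str X)" "str X 0 = X" if "X \<subseteq> {..<n}" for X :: "nat set"
    using that by (auto simp: is_struct_def str_def)
  \<comment> \<open>With \<open>k\<close> fixed, the budget bits are constants; only the
    \<open>n\<close> membership bits vary with \<open>X\<close>.\<close>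
  have inp: "lowdeg n 1 (\<lambda>X. of_bool (enc 1 n (str X) k j))" for k j
  proof (cases "j < n")
    case True
    then show ?thesis using lowdeg_input[of j n 1] by (simp add: enc_def str_def)
  next
    case False
    then show ?thesis by (simp add: enc_def lowdeg_const)
  qed
  have "approximable n l D ((n + 2) ^ c) (\<lambda>X. w n X \<le> k)" for k
  proof -
    have "l \<ge> 1" by (simp add: l_def)
    from circuit_approximable[of l n "\<lambda>X. enc 1 n (str X) k", OF this inp C(3)]
    have "approximable n l D ((n + 2) ^ c) (\<lambda>X. ceval (enc 1 n (str X) k) C)"
      unfolding D_def
      by (rule approximable_mono[OF _ power_increasing[OF C(1)] C(2)]) (use \<open>l \<ge> 1\<close> in simp)
    moreover have "{X \<in> Pow {..<n}. f X \<noteq> of_bool (ceval (enc 1 n (str X) k) C)} =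
        {X \<in> Pow {..<n}. f X \<noteq> of_bool (w n X \<le> k)}" for f :: "nat set \<Rightarrow> 3"
      using C(4) P[OF n(2)] str by auto
    ultimately show ?thesis unfolding approximable_def by simp
  qed
  then have "\<forall>k. \<exists>f. lowdeg n D f \<and>
      card {X \<in> Pow {..<n}. f X \<noteq> of_bool (w n X \<le> k)} * 2 ^ l \<le> (n + 2) ^ c * 2 ^ n"
    unfolding approximable_def by (rule allI)
  from choice[OF this] obtain F where F: "\<And>k. lowdeg n D (F k)"
    "\<And>k. card {X \<in> Pow {..<n}. F k X \<noteq> of_bool (w n X \<le> k)} * 2 ^ l \<le> (n + 2) ^ c * 2 ^ n"
    by auto
  \<comment> \<open>By \<open>alternating_threshold_sum\<close>, this is parity wherever all
    threshold approximations are right.\<close>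
  define g where "g X = (\<Sum>k\<le>n. (- 1) ^ k * F k X) + (\<Sum>k<n. (- 1) ^ k * F k X)" for X
  have "lowdeg n D g"
    unfolding g_def by (intro lowdeg_add lowdeg_sum lowdeg_scale F(1))
  define G where "G = {X \<in> Pow {..<n}. g X = chi {..<n} X}"
  define E where "E k = {X \<in> Pow {..<n}. F k X \<noteq> of_bool (w n X \<le> k)}" for k
  have sub: "Pow {..<n} - G \<subseteq> (\<Union>k\<le>n. E k)"
  proof
    fix X assume X: "X \<in> Pow {..<n} - G"
    show "X \<in> (\<Union>k\<le>n. E k)"
    proof (rule ccontr)
      assume "X \<notin> (\<Union>k\<le>n. E k)"
      then have "F k X = of_bool (w n X \<le> k)" if "k \<le> n" for k
        using X that by (auto simp: E_def)
      then have "g X = (\<Sum>k\<le>n. (- 1) ^ k * of_bool (w n X \<le> k)) +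
          (\<Sum>k<n. (- 1) ^ k * of_bool (w n X \<le> k))"
        unfolding g_def by simp
      also have "\<dots> = (- 1) ^ w n X"
        unfolding alternating_threshold_sum using w[of X n] X n(1) by auto
      also have "\<dots> = chi {..<n} X"
      proof -
        have "{..<n} \<inter> X = X" using X by auto
        then show ?thesis using w[of X n] X n(1) by (auto simp: chi_def minus_one_power_iff)
      qed
      finally show False using X by (simp add: G_def)
    qed
  qed
  have "8 * card (Pow {..<n} - G) \<le> 2 ^ n"
  proof -
    have "card (Pow {..<n} - G) \<le> (\<Sum>k\<le>n. card (E k))"
      using card_mono[OF _ sub] card_UN_le[of "{..n}" E] by (auto simp: E_def intro: le_trans)
    then have "card (Pow {..<n} - G) * 2 ^ l \<le> (\<Sum>k\<le>n. card (E k) * 2 ^ l)"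
      by (simp add: sum_distrib_right[symmetric])
    also have "\<dots> \<le> (\<Sum>k\<le>n. (n + 2) ^ c * 2 ^ n)"
      using F(2) by (intro sum_mono) (simp add: E_def)
    also have "\<dots> = (n + 1) * ((n + 2) ^ c * 2 ^ n)" by simp
    also have "\<dots> \<le> (n + 2) * ((n + 2) ^ c * 2 ^ n)" by (rule mult_le_mono1) simp
    also have "\<dots> = (n + 2) ^ (c + 1) * 2 ^ n" by (simp only: power_add power_one_right mult_ac)
    finally have "card (Pow {..<n} - G) * 2 ^ l \<le> (n + 2) ^ (c + 1) * 2 ^ n" .
    moreover have "8 * (n + 2) ^ (c + 1) \<le> 2 ^ l"
    proof -
      have "n + 2 \<le> 4 * n" using n by linarith
      also have "4 * n = 2 ^ (2 * (t + 1))" by (simp add: n_def power_mult)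
      finally have "(n + 2) ^ (c + 1) \<le> (2 ^ (2 * (t + 1))) ^ (c + 1)" by (rule power_mono) simp
      also have "\<dots> = 2 ^ (2 * (t + 1) * (c + 1))" by (rule power_mult[symmetric])
      finally show ?thesis by (simp add: l_def power_add)
    qed
    ultimately have "card (Pow {..<n} - G) * (8 * (n + 2) ^ (c + 1)) \<le> (n + 2) ^ (c + 1) * 2 ^ n"
      by (meson le_trans mult_le_mono2)
    then have "(n + 2) ^ (c + 1) * (8 * card (Pow {..<n} - G)) \<le> (n + 2) ^ (c + 1) * 2 ^ n"
      by (simp only: mult.commute mult.left_commute)
    then show ?thesis by (simp only: mult_le_cancel1) simp
  qed
  moreover have "card (Pow {..<n} - G) = 2 ^ n - card G" "card G \<le> 2 ^ n"
  proof -
    have "G \<subseteq> Pow {..<n}" by (auto simp: G_def)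
    then show "card (Pow {..<n} - G) = 2 ^ n - card G" "card G \<le> 2 ^ n"
      using card_mono[of "Pow {..<n}" G]
      by (simp_all add: card_Diff_subset card_Pow finite_subset[of G "Pow {..<n}"])
  qed
  ultimately have many: "7 * 2 ^ n \<le> 8 * card G" by linarith
  have "card G \<le> card (low n (m + D))"
    by (rule card_le_if_parity_lowdeg[of m, folded n(1), OF \<open>lowdeg n D g\<close>]) (auto simp: G_def)
  moreover have "2 * card (low n (m + D)) \<le> 4 ^ m + 2 * (D + 1) * ((2 * m) choose m)"
    unfolding n(1) by (rule card_low_le)
  \<comment> \<open>The central binomial coefficient is at most \<open>4 ^ m / 2 ^ t\<close>,
    because \<open>2 ^ t\<close> is the square root of \<open>2 * m\<close>; the choice of
    \<open>t\<close> absorbs the factor \<open>4 * (D + 1)\<close>.\<close>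
  moreover have "4 * (D + 1) * ((2 * m) choose m) \<le> 4 ^ m"
  proof -
    have "(2 ^ t) ^ 2 = 2 * m"
      unfolding n(1)[symmetric] n_def by (simp add: power2_eq_square flip: power_mult_distrib)
    then have "(((2 * m) choose m) * 2 ^ t) ^ 2 \<le> ((2 * m) choose m) ^ 2 * (2 * m + 1)"
      unfolding power_mult_distrib by simp
    also have "\<dots> \<le> 16 ^ m" by (rule central_binomial_square)
    also have "16 ^ m = ((4 :: nat) ^ m) ^ 2"
      by (simp add: power2_eq_square flip: power_mult_distrib)
    finally have "((2 * m) choose m) * 2 ^ t \<le> 4 ^ m" by (rule power2_le_imp_le) simp
    moreover have "4 * (D + 1) \<le> 2 ^ t" using t(2) by (simp add: D_def l_def)
    ultimately show ?thesis
      by (metis (no_types, lifting) le_trans mult.commute mult_le_mono1)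
  qed
  moreover have "(2 :: nat) ^ n = 4 ^ m" by (simp add: n(1) power_mult)
  moreover have "(4 :: nat) ^ m > 0" by simp
  \<comment> \<open>\<open>G\<close> contains at least 7/8 of all inputs, but the dimension bound
    allows at most 1/2 + 1/4.\<close>
  ultimately show False using many by linarith
qed

section \<open>Hard sentences for every pattern with a universal quantifier\<close>

lemma prenex_holds_append_const:
  assumes "n > 0" "\<And>\<tau>. prenex_holds n R qs' \<psi> \<tau> \<longleftrightarrow> B"
  shows "prenex_holds n R (qs @ qs') \<psi> \<sigma> \<longleftrightarrow> B"
proof (induction qs arbitrary: \<sigma>)
  case (Cons q qs)
  obtain Q v where "q = (Q, v)" by (cases q)
  then show ?case using Cons assms(1) by (cases Q) auto
qed (simp add: assms(2))

lemma prenex_holds_irrelevant: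
  assumes "n > 0" "qf_vars \<psi> \<inter> set (map snd qs) = {}"
  shows "prenex_holds n R qs \<psi> \<sigma> \<longleftrightarrow> qf_eval R \<sigma> \<psi>"
  using assms(2)
proof (induction qs arbitrary: \<sigma>)
  case (Cons q qs)
  obtain Q v where q: "q = (Q, v)" by (cases q)
  have "qf_eval R (\<sigma>(v := a)) \<psi> = qf_eval R \<sigma> \<psi>" for a
    using Cons.prems by (intro qf_eval_cong) (auto simp: q)
  then show ?case using Cons assms(1) by (cases Q) (auto simp: q)
qed simp

theorem RM_notin_AC0:
  assumes "subseq [QA] p"
  shows "\<exists>r qs \<psi>. is_sentence r qs \<psi> \<and> pattern qs = p \<and> \<not> in_AC0 r (RM m r qs \<psi>)"
proof -
  have "QA \<in> set p" using assms by (simp add: subseq_singleton_left)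
  then obtain p1 p2 where p: "p = p1 @ QA # p2" by (meson split_list)
  \<comment> \<open>One universal quantifier binds variable 0; all others bind the dummy variable 1,
    so the pattern is met without changing the meaning over a nonempty universe.\<close>
  define qs where "qs = map (\<lambda>q. (q, 1)) p1 @ (QA, 0) # map (\<lambda>q. (q, 1 :: nat)) p2"
  define \<psi> where "\<psi> = (if m = Add then Rel 0 0 else Neg (Rel 0 0))"
  define w where "w n X = (if m = Add then n - card X else card X)" for n and X :: "nat set"
  have vars: "qf_vars \<psi> = {0}" and sent: "is_sentence 1 qs \<psi>"
    by (auto simp: is_sentence_def qs_def \<psi>_def)
  have models: "models n R qs \<psi> \<longleftrightarrow> (\<forall>a<n. a \<in> R 0 \<longleftrightarrow> m = Add)" if "n > 0" for n R
    unfolding models_def qs_def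
  proof (rule prenex_holds_append_const[OF that])
    fix \<tau>
    have "prenex_holds n R (map (\<lambda>q. (q, 1)) p2) \<psi> \<sigma> \<longleftrightarrow> qf_eval R \<sigma> \<psi>" for \<sigma>
      using that vars by (intro prenex_holds_irrelevant) auto
    then show "prenex_holds n R ((QA, 0) # map (\<lambda>q. (q, 1)) p2) \<psi> \<tau> \<longleftrightarrow> (\<forall>a<n. a \<in> R 0 \<longleftrightarrow> m = Add)"
      by (auto simp: \<psi>_def)
  qed
  have "\<not> in_AC0 1 (RM m 1 qs \<psi>)"
  proof (rule counting_notin_AC0[where w = w])
    fix n k :: nat and R
    assume n: "n > 0" and R: "is_struct 1 n R"
    define T where "T = (if m = Add then {..<n} - R 0 else R 0)"
    have R0: "R 0 \<subseteq> {..<n}" using R by (simp add: is_struct_def)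
    have card: "card T = w n (R 0)"
      using R0 by (auto simp: T_def w_def card_Diff_subset finite_subset)
    \<comment> \<open>The sentence prescribes the resulting relation completely, so the modulator is
      forced and the question is only whether its size \<open>w n (R 0)\<close> fits the
      budget.\<close>
    have "S 0 = T" if "mod_ok m 1 n R S" "models n (apply_mod R S) qs \<psi>" for S
    proof -
      have S0: "S 0 \<subseteq> {..<n}" "m = Add \<Longrightarrow> S 0 \<inter> R 0 = {}"
        using that(1) by (auto simp: mod_ok_def is_struct_def)
      have "a \<in> S 0 \<longleftrightarrow> a \<in> T" for a
      proof (cases "a < n")
        case True
        then have "a \<in> apply_mod R S 0 \<longleftrightarrow> m = Add" using that(2) models[OF n] by blast
        then show ?thesis using True S0(2) by (cases "m = Add") (auto simp: T_def apply_mod_def)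
      next
        case False
        then show ?thesis using S0(1) R0 by (auto simp: T_def)
      qed
      then show ?thesis by blast
    qed
    moreover have "mod_ok m 1 n R (\<lambda>i. if i = 0 then T else {})"
      using R0 by (cases m) (auto simp: mod_ok_def is_struct_def T_def)
    moreover have "models n (apply_mod R (\<lambda>i. if i = 0 then T else {})) qs \<psi>"
      unfolding models[OF n] using R0 by (auto simp: apply_mod_def T_def)
    moreover have "mod_norm 1 S = card (S 0)" for S by (simp add: mod_norm_def)
    ultimately show "RM m 1 qs \<psi> n R k \<longleftrightarrow> w n (R 0) \<le> k"
      unfolding RM_def card[symmetric] by (metis (lifting))
  next
    fix n :: nat and X assume "X \<subseteq> {..<n}" "even n"
    moreover from this have "card X \<le> n" using card_mono[of "{..<n}" X] by simp
    ultimately show "w n X \<le> n \<and> (even (w n X) \<longleftrightarrow> even (card X))"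
      by (auto simp: w_def)
  qed
  moreover have "pattern qs = p" by (simp add: pattern_def qs_def p comp_def)
  ultimately show ?thesis using sent by blast
qed

theorem theorem4p15:
  fixes p :: "quant list" and m :: modmode
  shows "((\<exists>l. subseq p (replicate l QE)) \<longrightarrow>
            (\<forall>r qs \<psi>. is_sentence r qs \<psi> \<and> pattern qs = p \<longrightarrow> in_AC0 r (RM m r qs \<psi>)))
       \<and> (subseq [QA] p \<longrightarrow>
            (\<exists>r qs \<psi>. is_sentence r qs \<psi> \<and> pattern qs = p \<and> \<not> in_AC0 r (RM m r qs \<psi>))
          \<and> (\<forall>r qs \<psi>. is_sentence r qs \<psi> \<and> pattern qs = p \<longrightarrow> in_TC0 r (RM m r qs \<psi>)))"
proof (intro conjI impI allI)
  fix r qs \<psi>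
  assume "\<exists>l. subseq p (replicate l QE)" and s: "is_sentence r qs \<psi> \<and> pattern qs = p"
  then obtain l where "subseq p (replicate l QE)" by blast
  \<comment> \<open>A letter of \<open>p\<close> is a one-letter subsequence of \<open>p\<close>,
    hence by transitivity of the word of \<open>QE\<close>s.\<close>
  then have "q \<in> set (replicate l QE)" if "q \<in> set p" for q
    using that unfolding subseq_singleton_left[symmetric] by (rule subseq_order.trans[rotated])
  then have "set p \<subseteq> {QE}" by auto
  then show "in_AC0 r (RM m r qs \<psi>)"
    using s by (intro RM_in_AC0_if_existential) (auto simp: pattern_def)
qed (use RM_notin_AC0 RM_in_TC0 in blast)+

end
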